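(* Let $R$ be a based ring with universal grading $R=\bigoplus_{a\in U(R)}R_a$, let $M$ be an indecomposable based $R$-module, and let $M=\bigoplus_{x\in S}M_x$ be its decomposition into a direct sum of indecomposable based $R_{ad}$-submodules. There is a canonical structure of a transitive $U(R)$-set on the index set $S$ defined by the following property: for $a\in U(R)$ and $x,y\in S$, $$ax=y\quad\text{if and only if}\quad X_aV_x\in M_y \text{ for all } X_a\in R_a,\ V_x\in M_x.$$ Furthermore, $\mathrm{FPdim}(M_x)/\mathrm{FPdim}(M_y)=1$ for all $x,y\in S$.
   Context: A based ring is a pair $(R,B)$ where $R$ is a ring with identity, free of finite rank as a $\mathbb{Z}$-module, and $B=\{X_i\}_{i\in\mathcal{I}}$ is a $\mathbb{Z}$-basis of $R$ (its elements are called basic) such that $X_iX_j=\sum_{k}c_{ij}^kX_k$ with all $c_{ij}^k$ non-negative integers, the identity $1$ belongs to $B$ (all based rings are unital), and there is an involution $i\mapsto i^*$ of $\mathcal{I}$ whose induced map $X=\sum a_iX_i\mapsto X^*=\sum a_iX_{i^*}$ satisfies $(XY,Z)=(X,ZY^* )=(Y,X^*Z)$ for all $X,Y,Z\in R$, where $(\sum a_iX_i,\sum b_iX_i)=\sum a_ib_i$. A based subring is a subring spanned by a subset of $B$ that is itself a based ring with that basis. $R_{ad}$ is the minimal based subring of $R$ containing $X_iX_i^*$ for all $i$. Universal grading: a based $R_{ad}$-subbimodule of $R$ is the $\mathbb{Z}$-span of a subset of $B$ stable under left and right multiplication by $R_{ad}$. $R$ decomposes uniquely as a direct sum $R=\bigoplus_{a\in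 A}R_a$ of indecomposable based $R_{ad}$-subbimodules, and $A$ is a group with $ab=c$ if and only if $X_aX_b\in R_c$ for all $X_a\in R_a$, $X_b\in R_b$; its identity $1$ satisfies $R_1=R_{ad}$. This group is $U(R)$. A based (left) $R$-module is a left $R$-module $M$, free of finite rank over $\mathbb{Z}$, with a fixed basis $\{V_j\}_{j\in\mathcal{J}}$ (its elements are called basic) such that $X_iV_j=\sum_k d_{ij}^kV_k$ with $d_{ij}^k$ non-negative integers and $d_{ij}^k=d_{i^*k}^j$. Based submodules are submodules spanned by subsets of the basis; $M$ is indecomposable if it is nonzero and is not a direct sum of two nonzero based submodules. The decomposition of $M$ into indecomposable based $R_{ad}$-submodules exists and is unique up to a permutation of $S$. Frobenius-Perron dimensions: $\mathrm{FPdim}:R\to\mathbb{R}$ is the unique ring homomorphism taking positive values on basic elements. For indecomposable $M$ there is a unique up to positive scalar vector $Q=\sum_j\mu_jV_j\in M\otimes_{\mathbb{Z}}\mathbb{R}$ with all $\mu_j>0$ which is a common eigenvector of left multiplication by all $X\in R$ (with eigenvalue $\mathrm{FPdim}(X)$). Fix such a $Q$ and set $\mathrm{FPdim}(V_j)=\mu_j$ and $\mathrm{FPdim}(M_x)=\sum_{V_j\in M_x}\mathrm{FPdim}(V_j)^2$ for $x\in S$. The ratios $\mathrm{FPdim}(M_x)/\mathrm{FPdim}(M_y)$ do not depend on the choice of $Q$. *)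

theory Defs
  imports Complex_Main "HOL-Algebra.Algebra" "HOL-Algebra.Algebraic_Closure_Type"
begin

section \<open>Free abelian groups of finite rank with a fixed basis\<close>

text \<open>These notions use only the additive part of a record, so that they apply both to
  rings and to modules. They are meant for finite \<open>B\<close>.\<close>

definition int_comb :: "('a, 'e) ring_scheme \<Rightarrow> 'a set \<Rightarrow> ('a \<Rightarrow> int) \<Rightarrow> 'a" where
  "int_comb G B a = (\<Oplus>\<^bsub>G\<^esub>b\<in>B. add_pow G (a b) b)"

definition int_span :: "('a, 'e) ring_scheme \<Rightarrow> 'a set \<Rightarrow> 'a set" where
  "int_span G B = range (int_comb G B)"

definition int_basis :: "('a, 'e) ring_scheme \<Rightarrow> 'a set \<Rightarrow> bool" where
  "int_basis G B \<longleftrightarrow> finite B \<and> B \<subseteq> carrier G \<and>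
     (\<forall>x\<in>carrier G. \<exists>!a. a \<in> extensional B \<and> x = int_comb G B a)"

definition coord :: "('a, 'e) ring_scheme \<Rightarrow> 'a set \<Rightarrow> 'a \<Rightarrow> 'a \<Rightarrow> int" where
  "coord G B x = (THE a. a \<in> extensional B \<and> x = int_comb G B a)"

definition basis_form :: "('a, 'e) ring_scheme \<Rightarrow> 'a set \<Rightarrow> 'a \<Rightarrow> 'a \<Rightarrow> int" where
  "basis_form G B x y = (\<Sum>b\<in>B. coord G B x b * coord G B y b)"

section \<open>Direct sums and indecomposable summands\<close>

definition direct_sum_family ::
    "('a, 'e) ring_scheme \<Rightarrow> 'i set \<Rightarrow> ('i \<Rightarrow> 'a set) \<Rightarrow> bool" where
  "direct_sum_family G I N \<longleftrightarrow> finite I \<and>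
     (\<forall>i\<in>I. subgroup (N i) (add_monoid G)) \<and>
     (\<forall>x\<in>carrier G. \<exists>!f. f \<in> (\<Pi>\<^sub>E i\<in>I. N i) \<and> x = (\<Oplus>\<^bsub>G\<^esub>i\<in>I. f i))"

text \<open>\<open>P\<close> singles out the admissible subobjects (based submodules or based subbimodules).\<close>

definition indecomposable ::
    "('a, 'e) ring_scheme \<Rightarrow> ('a set \<Rightarrow> bool) \<Rightarrow> 'a set \<Rightarrow> bool" where
  "indecomposable G P N \<longleftrightarrow> P N \<and> N \<noteq> {\<zero>\<^bsub>G\<^esub>} \<and>
     \<not> (\<exists>K L. P K \<and> P L \<and> K \<noteq> {\<zero>\<^bsub>G\<^esub>} \<and> L \<noteq> {\<zero>\<^bsub>G\<^esub>} \<and>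
            N = K <+>\<^bsub>G\<^esub> L \<and> K \<inter> L = {\<zero>\<^bsub>G\<^esub>})"

definition indecomposable_decomposition ::
    "('a, 'e) ring_scheme \<Rightarrow> ('a set \<Rightarrow> bool) \<Rightarrow> 'i set \<Rightarrow> ('i \<Rightarrow> 'a set) \<Rightarrow> bool" where
  "indecomposable_decomposition G P I N \<longleftrightarrow>
     direct_sum_family G I N \<and> (\<forall>i\<in>I. indecomposable G P (N i))"

section \<open>Based rings\<close>

text \<open>The basis is indexed by itself, so the involution \<open>i \<mapsto> i\<^sup>*\<close> is a map \<open>star\<close> on \<open>B\<close>.
  It is determined by \<open>R\<close> and \<open>B\<close>, since \<open>(x y, 1) = (x, y\<^sup>*)\<close> for all basic \<open>x\<close>, \<open>y\<close>.\<close>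

definition star_extend ::
    "('a, 'e) ring_scheme \<Rightarrow> 'a set \<Rightarrow> ('a \<Rightarrow> 'a) \<Rightarrow> 'a \<Rightarrow> 'a" where
  "star_extend R B star x = (\<Oplus>\<^bsub>R\<^esub>b\<in>B. add_pow R (coord R B x b) (star b))"

locale based_ring = ring R for R (structure) +
  fixes B and star
  assumes basis: "int_basis R B"
    and one_basic: "\<one> \<in> B"
    and structure_nonneg: "\<lbrakk>x \<in> B; y \<in> B; z \<in> B\<rbrakk> \<Longrightarrow> 0 \<le> coord R B (x \<otimes> y) z"
    and star_closed: "x \<in> B \<Longrightarrow> star x \<in> B"
    and star_star: "x \<in> B \<Longrightarrow> star (star x) = x"
    and form_left: "\<lbrakk>x \<in> carrier R; y \<in> carrier R; z \<in> carrier R\<rbrakk> \<Longrightarrow>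
      basis_form R B (x \<otimes> y) z = basis_form R B x (z \<otimes> star_extend R B star y)"
    and form_right: "\<lbrakk>x \<in> carrier R; y \<in> carrier R; z \<in> carrier R\<rbrakk> \<Longrightarrow>
      basis_form R B (x \<otimes> y) z = basis_form R B y (star_extend R B star x \<otimes> z)"

definition based_subring :: "('a, 'e) ring_scheme \<Rightarrow> 'a set \<Rightarrow> 'a set \<Rightarrow> bool" where
  "based_subring R B T \<longleftrightarrow> (\<exists>D\<subseteq>B. T = int_span R D \<and> subring T R \<and>
     (\<exists>s. based_ring (R\<lparr>carrier := T\<rparr>) D s))"

definition adjoint_subring ::
    "('a, 'e) ring_scheme \<Rightarrow> 'a set \<Rightarrow> ('a \<Rightarrow> 'a) \<Rightarrow> 'a set" where
  "adjoint_subring R B star =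
     \<Inter>{T. based_subring R B T \<and> (\<forall>x\<in>B. x \<otimes>\<^bsub>R\<^esub> star x \<in> T)}"

definition based_subbimodule ::
    "('a, 'e) ring_scheme \<Rightarrow> 'a set \<Rightarrow> 'a set \<Rightarrow> 'a set \<Rightarrow> bool" where
  "based_subbimodule R B T N \<longleftrightarrow> (\<exists>D\<subseteq>B. N = int_span R D) \<and>
     (\<forall>x\<in>T. \<forall>y\<in>N. x \<otimes>\<^bsub>R\<^esub> y \<in> N \<and> y \<otimes>\<^bsub>R\<^esub> x \<in> N)"

text \<open>\<open>U\<close> is the universal grading group and \<open>Rc a\<close> the component of degree \<open>a\<close>.
  That the identity component is the adjoint subring is a consequence.\<close>

definition universal_grading ::
    "('a, 'e) ring_scheme \<Rightarrow> 'a set \<Rightarrow> ('a \<Rightarrow> 'a) \<Rightarrow> ('g, 'u) monoid_scheme \<Rightarrow>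
     ('g \<Rightarrow> 'a set) \<Rightarrow> bool" where
  "universal_grading R B star U Rc \<longleftrightarrow>
     indecomposable_decomposition R
       (based_subbimodule R B (adjoint_subring R B star)) (carrier U) Rc \<and>
     group U \<and>
     (\<forall>a\<in>carrier U. \<forall>b\<in>carrier U. \<forall>c\<in>carrier U.
        a \<otimes>\<^bsub>U\<^esub> b = c \<longleftrightarrow> (\<forall>x\<in>Rc a. \<forall>y\<in>Rc b. x \<otimes>\<^bsub>R\<^esub> y \<in> Rc c))"

section \<open>Based modules\<close>

text \<open>The library locale \<open>module\<close> requires a commutative ring of scalars.\<close>

locale left_module = R?: ring R + M?: abelian_group M
  for R :: "('a, 'e) ring_scheme" (structure) and M :: "('a, 'm, 'd) module_scheme" (structure) +
  assumes smult_closed: "\<lbrakk>a \<in> carrier R; x \<in> carrier M\<rbrakk> \<Longrightarrow> a \<odot>\<^bsub>M\<^esub> x \<in> carrier M"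
    and smult_l_distr: "\<lbrakk>a \<in> carrier R; b \<in> carrier R; x \<in> carrier M\<rbrakk> \<Longrightarrow>
      (a \<oplus> b) \<odot>\<^bsub>M\<^esub> x = a \<odot>\<^bsub>M\<^esub> x \<oplus>\<^bsub>M\<^esub> b \<odot>\<^bsub>M\<^esub> x"
    and smult_r_distr: "\<lbrakk>a \<in> carrier R; x \<in> carrier M; y \<in> carrier M\<rbrakk> \<Longrightarrow>
      a \<odot>\<^bsub>M\<^esub> (x \<oplus>\<^bsub>M\<^esub> y) = a \<odot>\<^bsub>M\<^esub> x \<oplus>\<^bsub>M\<^esub> a \<odot>\<^bsub>M\<^esub> y"
    and smult_assoc: "\<lbrakk>a \<in> carrier R; b \<in> carrier R; x \<in> carrier M\<rbrakk> \<Longrightarrow>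
      (a \<otimes> b) \<odot>\<^bsub>M\<^esub> x = a \<odot>\<^bsub>M\<^esub> (b \<odot>\<^bsub>M\<^esub> x)"
    and smult_one: "x \<in> carrier M \<Longrightarrow> \<one> \<odot>\<^bsub>M\<^esub> x = x"

locale based_module = based_ring R B star + left_module R M
  for R :: "('a, 'e) ring_scheme" (structure) and B and star
    and M :: "('a, 'm, 'd) module_scheme" (structure) +
  fixes C
  assumes module_basis: "int_basis M C"
    and action_nonneg: "\<lbrakk>x \<in> B; V \<in> C; W \<in> C\<rbrakk> \<Longrightarrow> 0 \<le> coord M C (x \<odot>\<^bsub>M\<^esub> V) W"
    and action_star: "\<lbrakk>x \<in> B; V \<in> C; W \<in> C\<rbrakk> \<Longrightarrow>
      coord M C (x \<odot>\<^bsub>M\<^esub> V) W = coord M C (star x \<odot>\<^bsub>M\<^esub> W) V"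

definition based_submodule ::
    "('a, 'm, 'e) module_scheme \<Rightarrow> 'm set \<Rightarrow> 'a set \<Rightarrow> 'm set \<Rightarrow> bool" where
  "based_submodule M C T N \<longleftrightarrow>
     (\<exists>D\<subseteq>C. N = int_span M D) \<and> (\<forall>x\<in>T. \<forall>V\<in>N. x \<odot>\<^bsub>M\<^esub> V \<in> N)"

section \<open>Frobenius-Perron dimensions\<close>

definition FPdim :: "('a, 'e) ring_scheme \<Rightarrow> 'a set \<Rightarrow> 'a \<Rightarrow> real" where
  "FPdim R B = (THE f. f \<in> extensional (carrier R) \<and>
     f \<in> ring_hom R (ring_of_type_algebra :: real ring) \<and> (\<forall>x\<in>B. 0 < f x))"

text \<open>\<open>FP_vector R B M C \<mu>\<close> says that \<open>Q = (\<Sum>V\<in>C. \<mu> V V)\<close> in the scalar extension of \<open>M\<close> to the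
  reals has positive coordinates and satisfies \<open>x Q = FPdim(x) Q\<close> for all \<open>x\<close>; the equation is
  written in coordinates, with \<open>W\<close> ranging over the basis.\<close>

definition FP_vector ::
    "('a, 'e) ring_scheme \<Rightarrow> 'a set \<Rightarrow> ('a, 'm, 'd) module_scheme \<Rightarrow> 'm set \<Rightarrow>
     ('m \<Rightarrow> real) \<Rightarrow> bool" where
  "FP_vector R B M C \<mu> \<longleftrightarrow> (\<forall>V\<in>C. 0 < \<mu> V) \<and>
     (\<forall>x\<in>carrier R. \<forall>W\<in>C.
        (\<Sum>V\<in>C. \<mu> V * real_of_int (coord M C (x \<odot>\<^bsub>M\<^esub> V) W)) = FPdim R B x * \<mu> W)"

definition FPdim_sub :: "'m set \<Rightarrow> ('m \<Rightarrow> real) \<Rightarrow> 'm set \<Rightarrow> real" where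
  "FPdim_sub C \<mu> N = (\<Sum>V\<in>C \<inter> N. (\<mu> V)\<^sup>2)"

end

theory Submission
  imports Defs
begin

text \<open>Everything is read off from supports: the set of basic elements that occur in a given
  element. Since all structure constants are non-negative, nothing cancels, and the support of a
  product of several basic elements is the union of the supports of the partial products
  (\<open>support_map_nonneg\<close>). By the duality axioms, the relation "\<open>W\<close> occurs in \<open>P V\<close> for some basic
  \<open>P\<close> in a \<open>star\<close>-closed based subring" is symmetric. Spans of subsets of the basis are therefore
  indecomposable only if the subset is connected for this relation
  (\<open>indecomposable_connected\<close>), which allows arguments by walking from one basic element to
  another.

  Write \<open>R_ad\<close> for the adjoint subring. It is the identity component of the universal grading
  (\<open>component_one\<close>), and \<open>star\<close> inverts degrees, so \<open>Y P (star Y)\<close> lies in \<open>R_ad\<close> for all basic \<open>Y\<close>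
  and all basic \<open>P\<close> in \<open>R_ad\<close> (\<open>conjugate_R_ad\<close>). Now let \<open>V\<close>, \<open>V'\<close> be basic in \<open>M\<^sub>x\<close> with
  \<open>V'\<close> occurring in \<open>P V\<close>, and let \<open>W\<close> occur in \<open>Y V\<close>. Then \<open>V\<close> occurs in \<open>(star Y) W\<close>, so whatever occurs in
  \<open>Y V'\<close> occurs in \<open>(Y P (star Y)) W\<close> and lies in the same summand as \<open>W\<close>
  (\<open>same_summand_step\<close>). Connectedness of \<open>M\<^sub>x\<close> shows that \<open>Y M\<^sub>x\<close> is contained in a single
  summand, and connectedness of \<open>R\<^sub>a\<close> that this summand depends only on the degree \<open>a\<close> of \<open>Y\<close>
  (\<open>component_same_summand\<close>). The summand is unique because no basic element of \<open>R\<close>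
  kills a basic element of \<open>M\<close>, which also turns the associativity of the module into the axioms of an action.
  Transitivity is connectedness of \<open>M\<close> itself.

  For the dimensions, let \<open>Y\<close> be basic of degree \<open>a\<close> and let \<open>Q\<^sub>x\<close> be the part of the eigenvector
  \<open>Q\<close> in \<open>M\<^sub>x\<close>. With \<open>y = a x\<close>, the eigenvector equation splits into \<open>Y Q\<^sub>x = d(Y) Q\<^sub>y\<close> and
  \<open>(star Y) Q\<^sub>y = d(star Y) Q\<^sub>x\<close>, where \<open>d\<close> denotes the Frobenius-Perron dimension. As \<open>star Y\<close> acts
  by the transposed matrix, \<open>d(Y) (Q\<^sub>y, Q\<^sub>y) = d(star Y) (Q\<^sub>x, Q\<^sub>x)\<close>. The same computation with \<open>Q\<close>
  in place of both parts gives \<open>d(Y) = d(star Y)\<close>, which is positive, so the two norms agree. They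
  are the dimensions of \<open>M\<^sub>y\<close> and \<open>M\<^sub>x\<close>.\<close>

section \<open>Coordinates in a free abelian group with a fixed basis\<close>

definition basis_support :: "('a, 'e) ring_scheme \<Rightarrow> 'a set \<Rightarrow> 'a \<Rightarrow> 'a set" where
  "basis_support G B x = {b \<in> B. coord G B x b \<noteq> 0}"

locale based_group = abelian_group G for G (structure) +
  fixes B
  assumes int_basis: "int_basis G B"
begin

lemma finite_basis: "finite B" and basis_subset: "B \<subseteq> carrier G"
  using int_basis unfolding int_basis_def by auto

lemma basis_carrier: "b \<in> B \<Longrightarrow> b \<in> carrier G"
  using basis_subset by blast

lemma add_pow_zero: "add_pow G (0::int) b = \<zero>"
  by (simp add: add_pow_def)

lemma int_comb_closed: "D \<subseteq> B \<Longrightarrow> int_comb G D a \<in> carrier G"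
  unfolding int_comb_def using basis_subset by (intro finsum_closed) (auto simp: Pi_def)

lemma int_comb_cong:
  assumes "D \<subseteq> B" "\<And>b. b \<in> D \<Longrightarrow> a b = a' b"
  shows "int_comb G D a = int_comb G D a'"
  unfolding int_comb_def using basis_subset assms
  by (intro finsum_cong') (auto simp: Pi_def)

lemma coord_unique_ex:
  "x \<in> carrier G \<Longrightarrow> \<exists>!a. a \<in> extensional B \<and> x = int_comb G B a"
  using int_basis unfolding int_basis_def by blast

lemma int_comb_coord: "x \<in> carrier G \<Longrightarrow> int_comb G B (coord G B x) = x"
  using theI'[OF coord_unique_ex[of x]] unfolding coord_def by simp

lemma coord_int_comb:
  assumes "b \<in> B"
  shows "coord G B (int_comb G B a) b = a b"
proof -
  have "int_comb G B a = int_comb G B (restrict a B)"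
    by (rule int_comb_cong) auto
  then have "coord G B (int_comb G B a) = restrict a B"
    unfolding coord_def
    by (intro the1_equality coord_unique_ex int_comb_closed) auto
  with assms show ?thesis by simp
qed

lemma coord_eqI:
  assumes "x \<in> carrier G" "y \<in> carrier G" "\<And>b. b \<in> B \<Longrightarrow> coord G B x b = coord G B y b"
  shows "x = y"
proof -
  have "int_comb G B (coord G B x) = int_comb G B (coord G B y)"
    by (rule int_comb_cong) (use assms(3) in auto)
  then show ?thesis by (simp add: int_comb_coord assms(1,2))
qed

lemma coord_add:
  assumes "x \<in> carrier G" "y \<in> carrier G" "b \<in> B"
  shows "coord G B (x \<oplus> y) b = coord G B x b + coord G B y b"
proof -
  have "int_comb G B (\<lambda>b. coord G B x b + coord G B y b)
      = (\<Oplus>b\<in>B. add_pow G (coord G B x b) b \<oplus> add_pow G (coord G B y b) b)"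
    unfolding int_comb_def using basis_subset
    by (intro finsum_cong') (auto simp: Pi_def add.int_pow_mult)
  also have "\<dots> = int_comb G B (coord G B x) \<oplus> int_comb G B (coord G B y)"
    unfolding int_comb_def using basis_subset by (intro finsum_addf) (auto simp: Pi_def)
  also have "\<dots> = x \<oplus> y" by (simp add: int_comb_coord assms)
  finally show ?thesis
    using coord_int_comb[OF assms(3), of "\<lambda>b. coord G B x b + coord G B y b"] by simp
qed

text \<open>Every matrix entry of an additive map is an additive functional, so this one expansion
  gives all the coordinate formulas for products, actions and inclusions.\<close>

lemma additive_functional_expand:
  fixes g :: "'a \<Rightarrow> int"
  assumes add: "\<And>x y. x \<in> carrier G \<Longrightarrow> y \<in> carrier G \<Longrightarrow> g (x \<oplus> y) = g x + g y"
    and x: "x \<in> carrier G"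
  shows "g x = (\<Sum>b\<in>B. coord G B x b * g b)"
proof -
  have zero: "g \<zero> = 0" using add[of \<zero> \<zero>] by simp
  have pow: "g (add_pow G k b) = k * g b" if b: "b \<in> carrier G" for k :: int and b
  proof (induction k rule: int_induct[where k = 0])
    case base
    show ?case using zero by (simp add: add_pow_zero)
  next
    case (step1 i)
    have "add_pow G (i + 1) b = add_pow G i b \<oplus> b"
      using add.int_pow_mult[OF b, of i 1] b by simp
    then show ?case using add[of "add_pow G i b" b] step1 b by (simp add: algebra_simps)
  next
    case (step2 i)
    have "add_pow G i b = add_pow G (i - 1) b \<oplus> b"
      using add.int_pow_mult[OF b, of "i - 1" 1] b by simp
    then show ?case using add[of "add_pow G (i - 1) b" b] step2 b by (simp add: algebra_simps)
  qed
  have comb: "g (\<Oplus>b\<in>F. add_pow G (a b) b) = (\<Sum>b\<in>F. a b * g b)"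
    if "finite F" "F \<subseteq> carrier G" for F and a :: "'a \<Rightarrow> int"
    using that
  proof (induction F)
    case empty
    then show ?case using zero by simp
  next
    case (insert b F)
    have "(\<Oplus>b\<in>insert b F. add_pow G (a b) b)
        = add_pow G (a b) b \<oplus> (\<Oplus>b\<in>F. add_pow G (a b) b)"
      using insert by (intro finsum_insert) (auto simp: Pi_def)
    moreover have "(\<Oplus>b\<in>F. add_pow G (a b) b) \<in> carrier G"
      using insert by (intro finsum_closed) (auto simp: Pi_def)
    ultimately show ?case using insert add pow by simp
  qed
  show ?thesis
    using comb[OF finite_basis basis_subset, of "coord G B x"] int_comb_coord[OF x]
    unfolding int_comb_def by simp
qed

lemma coord_zero: "b \<in> B \<Longrightarrow> coord G B \<zero> b = 0"
  using coord_add[of \<zero> \<zero> b] by simp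

lemma coord_basis:
  assumes "b \<in> B" "c \<in> B"
  shows "coord G B b c = (if c = b then 1 else 0)"
proof -
  have "int_comb G B (\<lambda>c. if c = b then 1 else 0) = (\<Oplus>c\<in>B. if b = c then c else \<zero>)"
    unfolding int_comb_def using basis_subset
    by (intro finsum_cong') (auto simp: Pi_def add_pow_zero)
  also have "\<dots> = b"
    using assms basis_subset finite_basis by (intro finsum_singleton) (auto simp: Pi_def)
  finally show ?thesis
    using coord_int_comb[OF assms(2), of "\<lambda>c. if c = b then 1 else 0"] by simp
qed

lemma nonzero_coord:
  assumes "x \<in> carrier G" "x \<noteq> \<zero>"
  obtains b where "b \<in> B" "coord G B x b \<noteq> 0"
proof -
  have "\<exists>b\<in>B. coord G B x b \<noteq> 0"
    using coord_eqI[of x \<zero>] assms by (auto simp: coord_zero)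
  then show ?thesis using that by blast
qed

lemma mem_int_span_iff:
  assumes "D \<subseteq> B"
  shows "x \<in> int_span G D \<longleftrightarrow> x \<in> carrier G \<and> (\<forall>b\<in>B. coord G B x b \<noteq> 0 \<longrightarrow> b \<in> D)"
proof -
  have extend: "int_comb G D a = int_comb G B (\<lambda>b. if b \<in> D then a b else 0)" for a
  proof -
    have "(\<Oplus>b\<in>D. add_pow G (a b) b) = (\<Oplus>b\<in>B. add_pow G (if b \<in> D then a b else 0) b)"
      using assms finite_basis basis_subset
      by (intro add.finprod_mono_neutral_cong_left) (auto simp: Pi_def add_pow_zero)
    then show ?thesis by (simp add: int_comb_def)
  qed
  show ?thesis
  proof
    assume "x \<in> int_span G D"
    then obtain a where x: "x = int_comb G D a" unfolding int_span_def by auto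
    show "x \<in> carrier G \<and> (\<forall>b\<in>B. coord G B x b \<noteq> 0 \<longrightarrow> b \<in> D)"
      using x extend[of a] by (auto simp: coord_int_comb int_comb_closed)
  next
    assume x: "x \<in> carrier G \<and> (\<forall>b\<in>B. coord G B x b \<noteq> 0 \<longrightarrow> b \<in> D)"
    have "int_comb G D (coord G B x) = int_comb G B (coord G B x)"
      by (subst extend, rule int_comb_cong) (use x in auto)
    then show "x \<in> int_span G D"
      using x int_comb_coord[of x] unfolding int_span_def by (auto intro: range_eqI[of _ _ "coord G B x"])
  qed
qed

lemma basis_mem_int_span_iff:
  "D \<subseteq> B \<Longrightarrow> b \<in> B \<Longrightarrow> b \<in> int_span G D \<longleftrightarrow> b \<in> D"
  using mem_int_span_iff[of D b] coord_basis[of b] basis_carrier[of b] by auto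

lemma zero_mem_int_span: "D \<subseteq> B \<Longrightarrow> \<zero> \<in> int_span G D"
  using mem_int_span_iff[of D \<zero>] coord_zero by auto

lemma basis_not_zero: "b \<in> B \<Longrightarrow> b \<noteq> \<zero>"
  using coord_basis[of b b] coord_zero[of b] by auto

lemma int_span_eq_zero_iff:
  assumes "D \<subseteq> B"
  shows "int_span G D = {\<zero>} \<longleftrightarrow> D = {}"
proof
  assume "int_span G D = {\<zero>}"
  then show "D = {}"
    using basis_mem_int_span_iff[OF assms] basis_not_zero assms by auto
next
  assume "D = {}"
  then show "int_span G D = {\<zero>}"
    using mem_int_span_iff[OF assms] zero_mem_int_span[OF assms] coord_eqI[of _ \<zero>]
    by (auto simp: coord_zero)
qed

lemma int_span_basis: "int_span G B = carrier G"
  using mem_int_span_iff[of B] by auto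

lemma int_span_Int:
  assumes "D \<subseteq> B" "E \<subseteq> B"
  shows "int_span G D \<inter> int_span G E = int_span G (D \<inter> E)"
proof -
  have "D \<inter> E \<subseteq> B" using assms by blast
  then show ?thesis using assms by (auto simp: mem_int_span_iff)
qed

lemma int_span_set_add:
  assumes "D \<subseteq> B" "E \<subseteq> B"
  shows "int_span G D <+>\<^bsub>G\<^esub> int_span G E = int_span G (D \<union> E)"
proof
  show "int_span G D <+>\<^bsub>G\<^esub> int_span G E \<subseteq> int_span G (D \<union> E)"
  proof
    fix x assume "x \<in> int_span G D <+>\<^bsub>G\<^esub> int_span G E"
    then obtain y z where yz: "y \<in> int_span G D" "z \<in> int_span G E" "x = y \<oplus> z"
      by (auto simp: set_add_def')
    have y: "y \<in> carrier G" "\<And>b. b \<in> B \<Longrightarrow> b \<notin> D \<Longrightarrow> coord G B y b = 0"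
      using yz(1) assms(1) by (auto simp: mem_int_span_iff)
    have z: "z \<in> carrier G" "\<And>b. b \<in> B \<Longrightarrow> b \<notin> E \<Longrightarrow> coord G B z b = 0"
      using yz(2) assms(2) by (auto simp: mem_int_span_iff)
    have "coord G B x b = 0" if "b \<in> B" "b \<notin> D" "b \<notin> E" for b
      using y z yz(3) that by (simp add: coord_add)
    moreover have "x \<in> carrier G" using y z yz(3) by simp
    ultimately show "x \<in> int_span G (D \<union> E)"
      using assms by (auto simp: mem_int_span_iff)
  qed
next
  show "int_span G (D \<union> E) \<subseteq> int_span G D <+>\<^bsub>G\<^esub> int_span G E"
  proof
    fix x assume x: "x \<in> int_span G (D \<union> E)"
    define y where "y = int_comb G B (\<lambda>b. if b \<in> D then coord G B x b else 0)"
    define z where "z = int_comb G B (\<lambda>b. if b \<in> D then 0 else coord G B x b)"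
    have y: "y \<in> int_span G D" unfolding y_def
      using assms by (auto simp: mem_int_span_iff int_comb_closed coord_int_comb split: if_splits)
    have z: "z \<in> int_span G E" unfolding z_def
      using assms x by (auto simp: mem_int_span_iff int_comb_closed coord_int_comb split: if_splits)
    have "x = y \<oplus> z"
    proof (rule coord_eqI)
      show "x \<in> carrier G" using x assms by (simp add: mem_int_span_iff)
      show "y \<oplus> z \<in> carrier G" unfolding y_def z_def by (simp add: int_comb_closed)
      show "coord G B x b = coord G B (y \<oplus> z) b" if "b \<in> B" for b
        unfolding y_def z_def using that
        by (simp add: coord_add int_comb_closed coord_int_comb)
    qed
    then show "x \<in> int_span G D <+>\<^bsub>G\<^esub> int_span G E" using y z by (auto simp: set_add_def')
  qed
qed

text \<open>If the admissible subobjects are the spans of the sets closed under a symmetric relation,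
  then the complement of a closed set is closed. Hence every connected component splits off as
  a direct summand, and an indecomposable subobject has only one component.\<close>

lemma indecomposable_connected:
  assumes N: "N = int_span G D" and D: "D \<subseteq> B"
    and P: "\<And>F. F \<subseteq> B \<Longrightarrow> P (int_span G F) \<longleftrightarrow> (\<forall>b\<in>F. \<forall>c\<in>B. E b c \<longrightarrow> c \<in> F)"
    and sym: "\<And>b c. b \<in> B \<Longrightarrow> c \<in> B \<Longrightarrow> E b c \<Longrightarrow> E c b"
    and ind: "indecomposable G P N"
    and b: "b \<in> D" and c: "c \<in> D"
  shows "(\<lambda>b c. b \<in> D \<and> c \<in> D \<and> E b c)\<^sup>*\<^sup>* b c"
proof (rule ccontr)
  let ?E = "\<lambda>b c. b \<in> D \<and> c \<in> D \<and> E b c"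
  assume not: "\<not> ?E\<^sup>*\<^sup>* b c"
  define K where "K = {d \<in> D. ?E\<^sup>*\<^sup>* b d}"
  have KD: "K \<subseteq> D" "K \<subseteq> B" "D - K \<subseteq> B" using D unfolding K_def by auto
  have closed: "d' \<in> D" if "d \<in> D" "d' \<in> B" "E d d'" for d d'
    using ind P[OF D] that unfolding indecomposable_def N by blast
  have K: "P (int_span G K)"
    by (subst P[OF KD(2)])
      (use closed in \<open>auto simp: K_def intro: rtranclp.rtrancl_into_rtrancl\<close>)
  have L: "P (int_span G (D - K))"
    unfolding P[OF KD(3)]
  proof (intro ballI impI)
    fix d d' assume d: "d \<in> D - K" "d' \<in> B" "E d d'"
    have "d' \<in> D" using closed d by blast
    moreover have "E d' d" using sym d D by blast
    ultimately show "d' \<in> D - K"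
      using d unfolding K_def by (auto intro: rtranclp.rtrancl_into_rtrancl)
  qed
  have "b \<in> K" "c \<in> D - K" using b c not unfolding K_def by auto
  then have "int_span G K \<noteq> {\<zero>}" "int_span G (D - K) \<noteq> {\<zero>}"
    using int_span_eq_zero_iff[OF KD(2)] int_span_eq_zero_iff[OF KD(3)] by auto
  moreover have "int_span G K \<inter> int_span G (D - K) = {\<zero>}"
    using int_span_Int[OF KD(2,3)] int_span_eq_zero_iff[of "{}"] by simp
  moreover have "N = int_span G K <+>\<^bsub>G\<^esub> int_span G (D - K)"
    using int_span_set_add[OF KD(2,3)] KD(1) N by (simp add: Un_absorb1)
  ultimately show False using ind K L unfolding indecomposable_def by blast
qed

lemma int_span_eq_basis_part:
  assumes "D \<subseteq> B" "N = int_span G D"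
  shows "D = B \<inter> N"
  using assms basis_mem_int_span_iff by blast

text \<open>The coordinate of \<open>b\<close> at \<open>b\<close> itself is 1, so \<open>b\<close> occurs in one of its components, and a
  subgroup spanned by basis elements contains every basis element that occurs in it.\<close>

lemma direct_sum_covers_basis:
  assumes ds: "direct_sum_family G I N"
    and N: "\<And>i. i \<in> I \<Longrightarrow> \<exists>D\<subseteq>B. N i = int_span G D"
    and b: "b \<in> B"
  shows "\<exists>i\<in>I. b \<in> N i"
proof -
  have "\<exists>!f. f \<in> (\<Pi>\<^sub>E i\<in>I. N i) \<and> b = (\<Oplus>i\<in>I. f i)"
    using ds basis_carrier[OF b] unfolding direct_sum_family_def by simp
  then obtain f where f: "f \<in> (\<Pi>\<^sub>E i\<in>I. N i)" "b = (\<Oplus>i\<in>I. f i)" by blast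
  have fin: "finite I" using ds unfolding direct_sum_family_def by blast
  have car: "f i \<in> carrier G" if i: "i \<in> I" for i
  proof -
    obtain D where D: "D \<subseteq> B" "N i = int_span G D" using N[OF i] by blast
    moreover have "f i \<in> N i" using PiE_mem[OF f(1) i] .
    ultimately show ?thesis using mem_int_span_iff[OF D(1)] by blast
  qed
  have "coord G B (\<Oplus>i\<in>J. f i) b = (\<Sum>i\<in>J. coord G B (f i) b)" if "finite J" "J \<subseteq> I" for J
    using that
  proof (induction J)
    case empty
    then show ?case by (simp add: coord_zero b)
  next
    case (insert i J)
    have "(\<Oplus>i\<in>J. f i) \<in> carrier G" using insert car by (intro finsum_closed) auto
    moreover have "(\<Oplus>i\<in>insert i J. f i) = f i \<oplus> (\<Oplus>i\<in>J. f i)"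
      using insert car by (intro finsum_insert) auto
    ultimately show ?case using insert car by (simp add: coord_add b)
  qed
  from this[OF fin subset_refl] have "(\<Sum>i\<in>I. coord G B (f i) b) \<noteq> 0"
    using f(2) coord_basis[OF b b] by simp
  then obtain i where i: "i \<in> I" "coord G B (f i) b \<noteq> 0" by (meson sum.neutral)
  obtain D where D: "D \<subseteq> B" "N i = int_span G D" using N[OF i(1)] by blast
  have "f i \<in> N i" using PiE_mem[OF f(1) i(1)] .
  then have "b \<in> N i" using D i b mem_int_span_iff[OF D(1)] basis_mem_int_span_iff[OF D(1) b] by blast
  then show ?thesis using i by blast
qed

text \<open>An element of two summands would have two decompositions, each with a single non-zero
  component.\<close>

lemma direct_sum_index_unique:
  assumes ds: "direct_sum_family G I N"
    and N: "\<And>i. i \<in> I \<Longrightarrow> \<exists>D\<subseteq>B. N i = int_span G D"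
    and ij: "i \<in> I" "j \<in> I" and b: "b \<in> N i" "b \<in> N j" "b \<noteq> \<zero>"
  shows "i = j"
proof (rule ccontr)
  assume neq: "i \<noteq> j"
  have fin: "finite I" using ds unfolding direct_sum_family_def by blast
  have bc: "b \<in> carrier G" using N[OF ij(1)] b mem_int_span_iff by blast
  have zero: "\<zero> \<in> N k" if "k \<in> I" for k
    using N[OF that] zero_mem_int_span by metis
  let ?f = "\<lambda>k. \<lambda>l\<in>I. if k = l then b else \<zero>"
  have "?f k \<in> (\<Pi>\<^sub>E l\<in>I. N l) \<and> b = (\<Oplus>l\<in>I. ?f k l)" if k: "k \<in> I" "b \<in> N k" for k
  proof
    show "?f k \<in> (\<Pi>\<^sub>E l\<in>I. N l)" using zero k by (auto simp: PiE_def)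
    have "(\<Oplus>l\<in>I. ?f k l) = (\<Oplus>l\<in>I. if k = l then b else \<zero>)"
      using bc by (intro finsum_cong') auto
    also have "\<dots> = b" using finsum_singleton[OF k(1) fin, of "\<lambda>_. b"] bc by simp
    finally show "b = (\<Oplus>l\<in>I. ?f k l)" by simp
  qed
  then have "?f i = ?f j"
    using ds bc ij b unfolding direct_sum_family_def by blast
  then have "?f i i = ?f j i" by metis
  with neq ij b(3) show False by simp
qed

lemma mem_int_span_support:
  "D \<subseteq> B \<Longrightarrow> x \<in> int_span G D \<longleftrightarrow> x \<in> carrier G \<and> basis_support G B x \<subseteq> D"
  using mem_int_span_iff[of D x] unfolding basis_support_def by blast

lemma mem_based_iff_support:
  assumes "\<exists>D\<subseteq>B. N = int_span G D"
  shows "x \<in> N \<longleftrightarrow> x \<in> carrier G \<and> basis_support G B x \<subseteq> N"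
proof -
  obtain D where D: "D \<subseteq> B" "N = int_span G D" using assms by blast
  have "basis_support G B x \<subseteq> B" by (auto simp: basis_support_def)
  then show ?thesis
    using mem_int_span_support[OF D(1)] int_span_eq_basis_part[OF D] D(2) by blast
qed

lemma basis_support_basis: "b \<in> B \<Longrightarrow> basis_support G B b = {b}"
  unfolding basis_support_def by (auto simp: coord_basis)

lemma basis_support_empty_iff: "x \<in> carrier G \<Longrightarrow> basis_support G B x = {} \<longleftrightarrow> x = \<zero>"
  using nonzero_coord[of x] unfolding basis_support_def by (auto simp: coord_zero)

lemma indecomposable_basis_nonempty:
  assumes "indecomposable G P N" "\<exists>D\<subseteq>B. N = int_span G D"
  shows "B \<inter> N \<noteq> {}"
proof -
  obtain D where D: "D \<subseteq> B" "N = int_span G D" using assms by blast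
  then show ?thesis
    using assms(1) int_span_eq_zero_iff[OF D(1)] int_span_eq_basis_part[OF D]
    unfolding indecomposable_def by blast
qed

end

locale based_group_map = G: based_group G B + H: based_group H C
  for G :: "('a, 'e) ring_scheme" and B and H :: "('b, 'f) ring_scheme" and C +
  fixes h :: "'a \<Rightarrow> 'b"
  assumes closed: "x \<in> carrier G \<Longrightarrow> h x \<in> carrier H"
    and additive: "x \<in> carrier G \<Longrightarrow> y \<in> carrier G \<Longrightarrow> h (x \<oplus>\<^bsub>G\<^esub> y) = h x \<oplus>\<^bsub>H\<^esub> h y"
begin

lemma coord_map:
  assumes "x \<in> carrier G" "c \<in> C"
  shows "coord H C (h x) c = (\<Sum>b\<in>B. coord G B x b * coord H C (h b) c)"
  using G.additive_functional_expand[of "\<lambda>x. coord H C (h x) c", OF _ assms(1)]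
    additive closed assms(2) H.coord_add by simp

lemma support_map_subset:
  assumes "x \<in> carrier G"
  shows "basis_support H C (h x) \<subseteq> (\<Union>b\<in>basis_support G B x. basis_support H C (h b))"
proof
  fix c assume c: "c \<in> basis_support H C (h x)"
  then have cC: "c \<in> C" and "(\<Sum>b\<in>B. coord G B x b * coord H C (h b) c) \<noteq> 0"
    using coord_map[OF assms] by (auto simp: basis_support_def)
  then obtain b where "b \<in> B" "coord G B x b * coord H C (h b) c \<noteq> 0"
    by (meson sum.neutral)
  with cC show "c \<in> (\<Union>b\<in>basis_support G B x. basis_support H C (h b))"
    by (auto simp: basis_support_def)
qed

text \<open>With non-negative coefficients there is no cancellation, so supports compose exactly.\<close>

lemma support_map_nonneg:
  assumes x: "x \<in> carrier G" and nonneg: "\<And>b. b \<in> B \<Longrightarrow> 0 \<le> coord G B x b"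
    and pos: "\<And>b c. b \<in> B \<Longrightarrow> c \<in> C \<Longrightarrow> 0 \<le> coord H C (h b) c"
  shows "basis_support H C (h x) = (\<Union>b\<in>basis_support G B x. basis_support H C (h b))"
proof
  show "(\<Union>b\<in>basis_support G B x. basis_support H C (h b)) \<subseteq> basis_support H C (h x)"
  proof
    fix c assume "c \<in> (\<Union>b\<in>basis_support G B x. basis_support H C (h b))"
    then obtain b where b: "b \<in> B" "c \<in> C" "coord G B x b \<noteq> 0" "coord H C (h b) c \<noteq> 0"
      by (auto simp: basis_support_def)
    have "(\<Sum>b\<in>B. coord G B x b * coord H C (h b) c) \<noteq> 0"
      using b nonneg pos G.finite_basis by (auto simp: sum_nonneg_eq_0_iff)
    then show "c \<in> basis_support H C (h x)"
      using b coord_map[OF x] by (auto simp: basis_support_def)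
  qed
qed (rule support_map_subset[OF x])

end

section \<open>Supports of products in a based ring\<close>

sublocale based_ring \<subseteq> based_group R B
  by unfold_locales (rule basis)

context based_ring
begin

abbreviation prod_supp :: "'a \<Rightarrow> 'a \<Rightarrow> 'a set" where
  "prod_supp x y \<equiv> basis_support R B (x \<otimes> y)"

lemma left_mult_map: "x \<in> carrier R \<Longrightarrow> based_group_map R B R B (\<lambda>y. x \<otimes> y)"
  by unfold_locales (auto simp: r_distr)

lemma right_mult_map: "x \<in> carrier R \<Longrightarrow> based_group_map R B R B (\<lambda>y. y \<otimes> x)"
  by unfold_locales (auto simp: l_distr)

lemma support_subset_basis: "basis_support R B x \<subseteq> B"
  by (auto simp: basis_support_def)

lemma star_extend_basis:
  assumes "Y \<in> B"
  shows "star_extend R B star Y = star Y"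
proof -
  have star: "star b \<in> carrier R" if "b \<in> B" for b using star_closed that basis_carrier by blast
  have "star_extend R B star Y = (\<Oplus>b\<in>B. if Y = b then star b else \<zero>)"
    unfolding star_extend_def using assms star coord_basis[OF assms]
    by (intro finsum_cong') (auto simp: add_pow_zero)
  also have "\<dots> = star Y"
    using assms finite_basis star by (intro finsum_singleton) auto
  finally show ?thesis .
qed

lemma basis_form_basis:
  assumes "b \<in> B"
  shows "basis_form R B x b = coord R B x b" "basis_form R B b x = coord R B x b"
proof -
  have "basis_form R B x b = (\<Sum>c\<in>B. if c = b then coord R B x b else 0)"
    unfolding basis_form_def using assms by (intro sum.cong) (auto simp: coord_basis)
  then show "basis_form R B x b = coord R B x b" using assms finite_basis by simp
  then show "basis_form R B b x = coord R B x b" by (simp add: basis_form_def mult.commute)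
qed

text \<open>The adjunction properties of the form make the relations "occurs in a product with a
  basic element from the left or from the right" symmetric, up to replacing that element by its
  dual.\<close>

lemma frobenius_left:
  assumes "P \<in> B" "Y \<in> B" "Z \<in> B"
  shows "coord R B (P \<otimes> Y) Z = coord R B (star P \<otimes> Z) Y"
  using form_right[OF assms[THEN basis_carrier]] assms
  by (simp add: basis_form_basis star_extend_basis)

lemma frobenius_right:
  assumes "P \<in> B" "Y \<in> B" "Z \<in> B"
  shows "coord R B (Y \<otimes> P) Z = coord R B (Z \<otimes> star P) Y"
  using form_left[OF assms(2,1,3)[THEN basis_carrier]] assms
  by (simp add: basis_form_basis star_extend_basis)

lemma one_support_mult_iff:
  assumes "Y \<in> B" "Z \<in> B"
  shows "\<one> \<in> prod_supp Y Z \<longleftrightarrow> Z = star Y"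
proof -
  have "coord R B (Y \<otimes> Z) \<one> = coord R B (star Y) Z"
    using frobenius_left[OF assms one_basic] star_closed[OF assms(1)] basis_carrier by simp
  then show ?thesis
    using one_basic assms star_closed[OF assms(1)] by (simp add: basis_support_def coord_basis)
qed

text \<open>The unit occurs in \<open>Y \<otimes> Z\<close> only for \<open>Z = star Y\<close>. Hence the involution that a based subring
  carries is the restriction of \<open>star\<close>.\<close>

lemma based_subring_star_closed:
  assumes T: "based_subring R B T" and Y: "Y \<in> B" "Y \<in> T"
  shows "star Y \<in> T"
proof -
  obtain D s where D: "D \<subseteq> B" "T = int_span R D" "subring T R"
    and s: "based_ring (R\<lparr>carrier := T\<rparr>) D s"
    using T unfolding based_subring_def by blast
  interpret T: based_ring "R\<lparr>carrier := T\<rparr>" D s by (rule s)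
  interpret incl: based_group_map "R\<lparr>carrier := T\<rparr>" D R B "\<lambda>x. x"
    using subringE(1)[OF D(3)] by unfold_locales auto
  have YD: "Y \<in> D" using int_span_eq_basis_part[OF D(1,2)] Y by blast
  have sD: "s Y \<in> D" using T.star_closed[OF YD] .
  have "\<one> \<in> basis_support R B (Y \<otimes> s Y)"
  proof -
    have "\<one> \<in> D" using T.one_basic by simp
    moreover have "coord (R\<lparr>carrier := T\<rparr>) D (Y \<otimes> s Y) \<one> \<noteq> 0"
      using T.one_support_mult_iff[OF YD sD] by (simp add: basis_support_def)
    \<comment> \<open>The inclusion maps the basis \<open>D\<close> into the basis \<open>B\<close>, so coordinates are preserved.\<close>
    moreover have "coord R B (Y \<otimes> s Y) \<one> = coord (R\<lparr>carrier := T\<rparr>) D (Y \<otimes> s Y) \<one>"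
    proof -
      have "Y \<otimes> s Y \<in> T"
        using subringE(6)[OF D(3)] T.basis_carrier[OF YD] T.basis_carrier[OF sD] by simp
      then have "coord R B (Y \<otimes> s Y) \<one>
          = (\<Sum>b\<in>D. coord (R\<lparr>carrier := T\<rparr>) D (Y \<otimes> s Y) b * coord R B b \<one>)"
        using incl.coord_map[of "Y \<otimes> s Y" \<one>] one_basic by simp
      also have "\<dots> = (\<Sum>b\<in>D. if b = \<one> then coord (R\<lparr>carrier := T\<rparr>) D (Y \<otimes> s Y) b else 0)"
        using D(1) one_basic by (intro sum.cong) (auto simp: coord_basis)
      also have "\<dots> = coord (R\<lparr>carrier := T\<rparr>) D (Y \<otimes> s Y) \<one>"
        using \<open>\<one> \<in> D\<close> T.finite_basis by simp
      finally show ?thesis .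
    qed
    ultimately show ?thesis using one_basic by (simp add: basis_support_def)
  qed
  then have "s Y = star Y" using one_support_mult_iff Y sD D(1) by blast
  then show ?thesis using T.basis_carrier[OF sD] by simp
qed

abbreviation "R_ad \<equiv> adjoint_subring R B star"

lemma based_subring_carrier: "based_subring R B (carrier R)"
  unfolding based_subring_def
  using int_span_basis carrier_is_subring based_ring_axioms by (intro exI[of _ B]) auto

lemma based_subring_based: "based_subring R B T \<Longrightarrow> \<exists>D\<subseteq>B. T = int_span R D"
  unfolding based_subring_def by blast

lemma R_ad_subset: "R_ad \<subseteq> carrier R"
  unfolding adjoint_subring_def
proof (rule Inter_lower)
  show "carrier R \<in> {T. based_subring R B T \<and> (\<forall>x\<in>B. x \<otimes> star x \<in> T)}"
    using based_subring_carrier by (auto simp: basis_carrier star_closed)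
qed

lemma R_ad_based: "R_ad = int_span R (B \<inter> R_ad)"
proof
  show "R_ad \<subseteq> int_span R (B \<inter> R_ad)"
  proof
    fix x assume x: "x \<in> R_ad"
    have "basis_support R B x \<subseteq> R_ad"
      using x mem_based_iff_support[OF based_subring_based]
      unfolding adjoint_subring_def by blast
    then show "x \<in> int_span R (B \<inter> R_ad)"
      using x R_ad_subset support_subset_basis[of x] mem_int_span_support[of "B \<inter> R_ad" x] by blast
  qed
  show "int_span R (B \<inter> R_ad) \<subseteq> R_ad"
  proof
    fix x assume "x \<in> int_span R (B \<inter> R_ad)"
    then have "x \<in> carrier R" "basis_support R B x \<subseteq> R_ad"
      using mem_int_span_support[of "B \<inter> R_ad" x] by auto
    then show "x \<in> R_ad"
      using mem_based_iff_support[OF based_subring_based, of _ x]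
      unfolding adjoint_subring_def by blast
  qed
qed

lemma R_ad_star: "Y \<in> B \<Longrightarrow> Y \<in> R_ad \<Longrightarrow> star Y \<in> R_ad"
  unfolding adjoint_subring_def by (auto intro: based_subring_star_closed)

lemma based_subring_subring: "based_subring R B T \<Longrightarrow> subring T R"
  unfolding based_subring_def by blast

lemma R_ad_mult: "x \<in> R_ad \<Longrightarrow> y \<in> R_ad \<Longrightarrow> x \<otimes> y \<in> R_ad"
  unfolding adjoint_subring_def by (auto intro: subringE(6)[OF based_subring_subring])

lemma R_ad_one: "\<one> \<in> R_ad"
  unfolding adjoint_subring_def by (auto intro: subringE(3)[OF based_subring_subring])

lemma R_ad_support: "x \<in> R_ad \<Longrightarrow> basis_support R B x \<subseteq> R_ad"
proof -
  have "\<exists>D\<subseteq>B. R_ad = int_span R D" using R_ad_based by blast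
  then show "x \<in> R_ad \<Longrightarrow> basis_support R B x \<subseteq> R_ad"
    using mem_based_iff_support[of R_ad x] by blast
qed

definition bimod_adj :: "'a \<Rightarrow> 'a \<Rightarrow> bool" where
  "bimod_adj Y Z \<longleftrightarrow> (\<exists>P\<in>B \<inter> R_ad. Z \<in> prod_supp P Y \<or> Z \<in> prod_supp Y P)"

lemma bimod_adj_sym:
  assumes "Y \<in> B" "Z \<in> B" "bimod_adj Y Z"
  shows "bimod_adj Z Y"
proof -
  obtain P where P: "P \<in> B" "P \<in> R_ad" "Z \<in> prod_supp P Y \<or> Z \<in> prod_supp Y P"
    using assms unfolding bimod_adj_def by blast
  then have "Y \<in> prod_supp (star P) Z \<or> Y \<in> prod_supp Z (star P)"
    using frobenius_left[of P Y Z] frobenius_right[of P Y Z] assms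
    by (auto simp: basis_support_def)
  then show ?thesis
    using star_closed R_ad_star P unfolding bimod_adj_def by blast
qed

lemma based_subbimodule_iff:
  assumes D: "D \<subseteq> B"
  shows "based_subbimodule R B R_ad (int_span R D) \<longleftrightarrow>
    (\<forall>Y\<in>D. \<forall>Z\<in>B. bimod_adj Y Z \<longrightarrow> Z \<in> D)"
proof
  assume sub: "based_subbimodule R B R_ad (int_span R D)"
  show "\<forall>Y\<in>D. \<forall>Z\<in>B. bimod_adj Y Z \<longrightarrow> Z \<in> D"
  proof (intro ballI impI)
    fix Y Z assume Y: "Y \<in> D" and Z: "Z \<in> B" and adj: "bimod_adj Y Z"
    obtain P where P: "P \<in> R_ad" "Z \<in> prod_supp P Y \<or> Z \<in> prod_supp Y P"
      using adj unfolding bimod_adj_def by blast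
    have "Y \<in> int_span R D" using basis_mem_int_span_iff D Y by blast
    then have "P \<otimes> Y \<in> int_span R D" "Y \<otimes> P \<in> int_span R D"
      using sub P unfolding based_subbimodule_def by blast+
    then show "Z \<in> D" using P(2) mem_int_span_support[OF D] by blast
  qed
next
  assume closed: "\<forall>Y\<in>D. \<forall>Z\<in>B. bimod_adj Y Z \<longrightarrow> Z \<in> D"
  have "x \<otimes> y \<in> int_span R D \<and> y \<otimes> x \<in> int_span R D"
    if x: "x \<in> R_ad" and y: "y \<in> int_span R D" for x y
  proof -
    have xc: "x \<in> carrier R" and xs: "basis_support R B x \<subseteq> B \<inter> R_ad"
      using x R_ad_subset R_ad_support support_subset_basis by auto
    have yc: "y \<in> carrier R" and ys: "basis_support R B y \<subseteq> D"
      using y mem_int_span_support[OF D] by auto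
    have "prod_supp P Z \<subseteq> D" "prod_supp Z P \<subseteq> D"
      if "P \<in> basis_support R B x" "Z \<in> basis_support R B y" for P Z
    proof -
      have "Z \<in> D" "P \<in> B \<inter> R_ad" using that xs ys by auto
      then show "prod_supp P Z \<subseteq> D" "prod_supp Z P \<subseteq> D"
        using closed support_subset_basis unfolding bimod_adj_def by blast+
    qed
    moreover have "prod_supp x y \<subseteq> (\<Union>Z\<in>basis_support R B y. prod_supp x Z)"
      "prod_supp y x \<subseteq> (\<Union>Z\<in>basis_support R B y. prod_supp Z x)"
      using based_group_map.support_map_subset[OF left_mult_map[OF xc] yc]
        based_group_map.support_map_subset[OF right_mult_map[OF xc] yc] by auto
    moreover have "prod_supp x Z \<subseteq> (\<Union>P\<in>basis_support R B x. prod_supp P Z)"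
      "prod_supp Z x \<subseteq> (\<Union>P\<in>basis_support R B x. prod_supp Z P)" if "Z \<in> D" for Z
    proof -
      have Yc: "Z \<in> carrier R" using that D basis_carrier by blast
      show "prod_supp x Z \<subseteq> (\<Union>P\<in>basis_support R B x. prod_supp P Z)"
        "prod_supp Z x \<subseteq> (\<Union>P\<in>basis_support R B x. prod_supp Z P)"
        using based_group_map.support_map_subset[OF left_mult_map[OF Yc] xc]
          based_group_map.support_map_subset[OF right_mult_map[OF Yc] xc] by auto
    qed
    ultimately have "prod_supp x y \<subseteq> D" "prod_supp y x \<subseteq> D"
      using ys by blast+
    then show ?thesis using mem_int_span_support[OF D] xc yc by simp
  qed
  then show "based_subbimodule R B R_ad (int_span R D)"
    using D unfolding based_subbimodule_def by blast
qed

end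

section \<open>The universal grading\<close>

locale graded_based_ring = based_ring R B star for R (structure) and B and star +
  fixes U (structure) and Rc
  assumes grading: "universal_grading R B star U Rc"
begin

sublocale U: group U
  using grading unfolding universal_grading_def by blast

lemma component_mult:
  "\<lbrakk>a \<in> carrier U; b \<in> carrier U; x \<in> Rc a; y \<in> Rc b\<rbrakk> \<Longrightarrow> x \<otimes>\<^bsub>R\<^esub> y \<in> Rc (a \<otimes>\<^bsub>U\<^esub> b)"
  using grading U.m_closed unfolding universal_grading_def by blast

lemma component_indecomposable:
  "a \<in> carrier U \<Longrightarrow> indecomposable R (based_subbimodule R B R_ad) (Rc a)"
  using grading unfolding universal_grading_def indecomposable_decomposition_def by blast

lemma component_based: "a \<in> carrier U \<Longrightarrow> \<exists>D\<subseteq>B. Rc a = int_span R D"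
  using component_indecomposable unfolding indecomposable_def based_subbimodule_def by blast

lemma component_sum: "direct_sum_family R (carrier U) Rc"
  using grading unfolding universal_grading_def indecomposable_decomposition_def by blast

lemma basis_component:
  assumes "Y \<in> B"
  obtains a where "a \<in> carrier U" "Y \<in> Rc a"
proof -
  have "\<exists>a\<in>carrier U. Y \<in> Rc a"
    by (rule direct_sum_covers_basis[OF component_sum component_based assms])
  then show ?thesis using that by blast
qed

lemma component_unique:
  "\<lbrakk>a \<in> carrier U; b \<in> carrier U; x \<in> Rc a; x \<in> Rc b; x \<noteq> \<zero>\<^bsub>R\<^esub>\<rbrakk> \<Longrightarrow> a = b"
  by (rule direct_sum_index_unique[OF component_sum component_based])

lemma component_basis_nonempty:
  assumes "a \<in> carrier U"
  obtains Y where "Y \<in> B" "Y \<in> Rc a"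
  using indecomposable_basis_nonempty[OF component_indecomposable[OF assms]
      component_based[OF assms]] that by blast

lemma component_connected:
  assumes a: "a \<in> carrier U" and Y: "Y \<in> B" "Y \<in> Rc a" and Z: "Z \<in> B" "Z \<in> Rc a"
  shows "(\<lambda>Y Z. Y \<in> B \<inter> Rc a \<and> Z \<in> B \<inter> Rc a \<and> bimod_adj Y Z)\<^sup>*\<^sup>* Y Z"
proof -
  obtain D where D: "D \<subseteq> B" "Rc a = int_span R D" using component_based[OF a] by blast
  have DB: "D = B \<inter> Rc a" by (rule int_span_eq_basis_part[OF D])
  show ?thesis
    using indecomposable_connected[OF D(2) D(1) based_subbimodule_iff bimod_adj_sym
        component_indecomposable[OF a], of Y Z] Y Z unfolding DB by blast
qed

lemma one_component: "\<one>\<^bsub>R\<^esub> \<in> Rc \<one>\<^bsub>U\<^esub>"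
proof -
  obtain c where c: "c \<in> carrier U" "\<one>\<^bsub>R\<^esub> \<in> Rc c" by (rule basis_component[OF one_basic])
  have "\<one>\<^bsub>R\<^esub> \<in> Rc (c \<otimes>\<^bsub>U\<^esub> c)" using component_mult[OF c(1) c(1) c(2) c(2)] by simp
  then have "c \<otimes>\<^bsub>U\<^esub> c = c"
    using component_unique c basis_not_zero[OF one_basic] by blast
  then show ?thesis using c U.r_cancel_one by simp
qed

text \<open>The identity component is connected and contains the unit, from which only the adjoint
  subring can be reached.\<close>

lemma component_one: "Y \<in> B \<Longrightarrow> Y \<in> Rc \<one>\<^bsub>U\<^esub> \<longleftrightarrow> Y \<in> R_ad"
proof
  assume Y: "Y \<in> B" "Y \<in> R_ad"
  have "based_subbimodule R B R_ad (Rc \<one>\<^bsub>U\<^esub>)"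
    using component_indecomposable[OF U.one_closed] unfolding indecomposable_def by blast
  then have "Y \<otimes>\<^bsub>R\<^esub> \<one>\<^bsub>R\<^esub> \<in> Rc \<one>\<^bsub>U\<^esub>"
    using one_component Y unfolding based_subbimodule_def by blast
  then show "Y \<in> Rc \<one>\<^bsub>U\<^esub>" using Y basis_carrier by simp
next
  assume Y: "Y \<in> B" "Y \<in> Rc \<one>\<^bsub>U\<^esub>"
  from component_connected[OF U.one_closed one_basic one_component Y]
  show "Y \<in> R_ad"
  proof (induction rule: rtranclp_induct)
    case base
    then show ?case by (rule R_ad_one)
  next
    case (step Z Z')
    then show ?case using R_ad_mult R_ad_support unfolding bimod_adj_def by blast
  qed
qed

text \<open>The unit occurs in \<open>Y \<otimes> star Y\<close>, so this product has degree 1.\<close>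

lemma star_component:
  assumes a: "a \<in> carrier U" and Y: "Y \<in> B" "Y \<in> Rc a"
  shows "star Y \<in> Rc (inv\<^bsub>U\<^esub> a)"
proof -
  obtain b where b: "b \<in> carrier U" "star Y \<in> Rc b"
    by (rule basis_component[OF star_closed[OF Y(1)]])
  have ab: "a \<otimes>\<^bsub>U\<^esub> b \<in> carrier U" by (rule U.m_closed[OF a b(1)])
  have "Y \<otimes>\<^bsub>R\<^esub> star Y \<in> Rc (a \<otimes>\<^bsub>U\<^esub> b)"
    by (rule component_mult[OF a b(1) Y(2) b(2)])
  then have "\<one>\<^bsub>R\<^esub> \<in> Rc (a \<otimes>\<^bsub>U\<^esub> b)"
    using mem_based_iff_support[OF component_based[OF ab]]
      one_support_mult_iff[OF Y(1) star_closed[OF Y(1)]] by blast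
  then have "a \<otimes>\<^bsub>U\<^esub> b = \<one>\<^bsub>U\<^esub>"
    using component_unique[OF ab U.one_closed] one_component basis_not_zero[OF one_basic] by blast
  then have "b = inv\<^bsub>U\<^esub> a" using U.inv_equality[OF U.inv_comm] a b by simp
  then show ?thesis using b by simp
qed

text \<open>The adjoint subring is normalised by every basic element, because it is the identity
  component of a grading by a group.\<close>

lemma conjugate_R_ad:
  assumes Y: "Y \<in> B" and P: "P \<in> B" "P \<in> R_ad"
    and Z: "Z \<in> prod_supp P (star Y)" and Q: "Q \<in> prod_supp Y Z"
  shows "Q \<in> R_ad"
proof -
  obtain a where a: "a \<in> carrier U" "Y \<in> Rc a" by (rule basis_component[OF Y])
  have a': "inv\<^bsub>U\<^esub> a \<in> carrier U" using a by simp
  have "P \<otimes>\<^bsub>R\<^esub> star Y \<in> Rc (\<one>\<^bsub>U\<^esub> \<otimes>\<^bsub>U\<^esub> inv\<^bsub>U\<^esub> a)"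
    using component_mult[OF U.one_closed a'] component_one P star_component[OF a(1) Y a(2)] by blast
  then have "P \<otimes>\<^bsub>R\<^esub> star Y \<in> Rc (inv\<^bsub>U\<^esub> a)" using a' by simp
  then have "Z \<in> Rc (inv\<^bsub>U\<^esub> a)"
    using mem_based_iff_support[OF component_based[OF a']] Z by blast
  then have "Y \<otimes>\<^bsub>R\<^esub> Z \<in> Rc (a \<otimes>\<^bsub>U\<^esub> inv\<^bsub>U\<^esub> a)"
    by (rule component_mult[OF a(1) a' a(2)])
  then have "Y \<otimes>\<^bsub>R\<^esub> Z \<in> Rc \<one>\<^bsub>U\<^esub>" using a by simp
  then have "Q \<in> Rc \<one>\<^bsub>U\<^esub>"
    using mem_based_iff_support[OF component_based[OF U.one_closed]] Q by blast
  then show ?thesis using component_one Q support_subset_basis by blast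
qed

end

section \<open>Supports in a based module\<close>

sublocale based_module \<subseteq> M_basis: based_group M C
  by unfold_locales (rule module_basis)

context based_module
begin

abbreviation act_supp :: "'a \<Rightarrow> 'm \<Rightarrow> 'm set" where
  "act_supp x v \<equiv> basis_support M C (x \<odot>\<^bsub>M\<^esub> v)"

lemma act_supp_subset_basis: "act_supp x v \<subseteq> C"
  by (auto simp: basis_support_def)

lemma act_map: "x \<in> carrier R \<Longrightarrow> based_group_map M C M C (\<lambda>v. x \<odot>\<^bsub>M\<^esub> v)"
  by unfold_locales (auto intro: smult_closed smult_r_distr)

lemma scalar_map: "v \<in> carrier M \<Longrightarrow> based_group_map R B M C (\<lambda>x. x \<odot>\<^bsub>M\<^esub> v)"
  by unfold_locales (auto intro: smult_closed smult_l_distr)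

lemma act_supp_mult:
  assumes "Y \<in> B" "Z \<in> B" "V \<in> C"
  shows "act_supp (Y \<otimes> Z) V = (\<Union>P\<in>prod_supp Y Z. act_supp P V)"
proof (rule based_group_map.support_map_nonneg[OF scalar_map])
  show "V \<in> carrier M" by (rule M_basis.basis_carrier[OF assms(3)])
  show "Y \<otimes> Z \<in> carrier R" using assms basis_carrier by simp
  show "0 \<le> coord R B (Y \<otimes> Z) b" if "b \<in> B" for b
    by (rule structure_nonneg[OF assms(1,2) that])
  show "0 \<le> coord M C (b \<odot>\<^bsub>M\<^esub> V) W" if "b \<in> B" "W \<in> C" for b W
    by (rule action_nonneg[OF that(1) assms(3) that(2)])
qed

lemma act_supp_act:
  assumes "Y \<in> B" "Z \<in> B" "V \<in> C"
  shows "act_supp Y (Z \<odot>\<^bsub>M\<^esub> V) = (\<Union>W\<in>act_supp Z V. act_supp Y W)"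
proof (rule based_group_map.support_map_nonneg[OF act_map])
  show "Y \<in> carrier R" by (rule basis_carrier[OF assms(1)])
  show "Z \<odot>\<^bsub>M\<^esub> V \<in> carrier M"
    by (rule smult_closed[OF basis_carrier[OF assms(2)] M_basis.basis_carrier[OF assms(3)]])
  show "0 \<le> coord M C (Z \<odot>\<^bsub>M\<^esub> V) W" if "W \<in> C" for W
    by (rule action_nonneg[OF assms(2,3) that])
  show "0 \<le> coord M C (Y \<odot>\<^bsub>M\<^esub> V) W" if "V \<in> C" "W \<in> C" for V W
    by (rule action_nonneg[OF assms(1) that])
qed

lemma act_supp_compose:
  assumes "Y \<in> B" "Z \<in> B" "V \<in> C"
  shows "(\<Union>P\<in>prod_supp Y Z. act_supp P V) = (\<Union>W\<in>act_supp Z V. act_supp Y W)"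
  using act_supp_mult[OF assms] act_supp_act[OF assms]
    smult_assoc[OF assms(1,2)[THEN basis_carrier] M_basis.basis_carrier[OF assms(3)]] by simp

lemma act_supp_sym:
  assumes "Y \<in> B" "V \<in> C" "W \<in> C"
  shows "W \<in> act_supp Y V \<longleftrightarrow> V \<in> act_supp (star Y) W"
  using action_star[OF assms] assms by (simp add: basis_support_def)

lemma act_supp_one: "V \<in> C \<Longrightarrow> act_supp \<one> V = {V}"
  using smult_one[OF M_basis.basis_carrier] M_basis.basis_support_basis by simp

text \<open>The product \<open>star Y \<otimes> Y\<close> contains the unit, so \<open>Y\<close> kills no basic element.\<close>

lemma act_supp_nonempty:
  assumes "Y \<in> B" "V \<in> C"
  shows "act_supp Y V \<noteq> {}"
proof -
  have "\<one> \<in> prod_supp (star Y) Y"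
    using one_support_mult_iff[OF star_closed[OF assms(1)] assms(1)] star_star[OF assms(1)] by simp
  then have "V \<in> (\<Union>P\<in>prod_supp (star Y) Y. act_supp P V)"
    using act_supp_one[OF assms(2)] by blast
  then show ?thesis
    using act_supp_compose[OF star_closed[OF assms(1)] assms] by blast
qed

definition mod_adj :: "'a set \<Rightarrow> 'm \<Rightarrow> 'm \<Rightarrow> bool" where
  "mod_adj T V W \<longleftrightarrow> (\<exists>P\<in>B \<inter> T. W \<in> act_supp P V)"

lemma mod_adj_sym:
  assumes "\<And>P. P \<in> B \<inter> T \<Longrightarrow> star P \<in> T" and VW: "V \<in> C" "W \<in> C" "mod_adj T V W"
  shows "mod_adj T W V"
proof -
  obtain P where P: "P \<in> B \<inter> T" "W \<in> act_supp P V" using VW unfolding mod_adj_def by blast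
  then have "V \<in> act_supp (star P) W" using act_supp_sym[of P V W] VW by blast
  then show ?thesis using assms(1)[OF P(1)] star_closed P unfolding mod_adj_def by blast
qed

lemma act_supp_subset:
  assumes "x \<in> carrier R" "v \<in> carrier M"
  shows "act_supp x v
    \<subseteq> (\<Union>P\<in>basis_support R B x. \<Union>V\<in>basis_support M C v. act_supp P V)"
proof -
  have "act_supp x v \<subseteq> (\<Union>V\<in>basis_support M C v. act_supp x V)"
    by (rule based_group_map.support_map_subset[OF act_map[OF assms(1)] assms(2)])
  moreover have "act_supp x V \<subseteq> (\<Union>P\<in>basis_support R B x. act_supp P V)"
    if "V \<in> basis_support M C v" for V
  proof -
    have "V \<in> carrier M" using that M_basis.basis_carrier by (auto simp: basis_support_def)
    then show ?thesis
      by (rule based_group_map.support_map_subset[OF scalar_map assms(1)])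
  qed
  ultimately show ?thesis by blast
qed

lemma based_submodule_iff:
  assumes T: "T \<subseteq> carrier R" "\<And>x. x \<in> T \<Longrightarrow> basis_support R B x \<subseteq> T" and D: "D \<subseteq> C"
  shows "based_submodule M C T (int_span M D) \<longleftrightarrow>
    (\<forall>V\<in>D. \<forall>W\<in>C. mod_adj T V W \<longrightarrow> W \<in> D)"
proof
  assume sub: "based_submodule M C T (int_span M D)"
  show "\<forall>V\<in>D. \<forall>W\<in>C. mod_adj T V W \<longrightarrow> W \<in> D"
  proof (intro ballI impI)
    fix V W assume V: "V \<in> D" and W: "W \<in> C" and adj: "mod_adj T V W"
    obtain P where P: "P \<in> T" "W \<in> act_supp P V" using adj unfolding mod_adj_def by blast
    have "V \<in> int_span M D" using M_basis.basis_mem_int_span_iff[OF D] D V by blast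
    then have "P \<odot>\<^bsub>M\<^esub> V \<in> int_span M D" using sub P unfolding based_submodule_def by blast
    then show "W \<in> D" using P(2) M_basis.mem_int_span_support[OF D] by blast
  qed
next
  assume closed: "\<forall>V\<in>D. \<forall>W\<in>C. mod_adj T V W \<longrightarrow> W \<in> D"
  have "x \<odot>\<^bsub>M\<^esub> v \<in> int_span M D" if x: "x \<in> T" and v: "v \<in> int_span M D" for x v
  proof -
    have xc: "x \<in> carrier R" and xs: "basis_support R B x \<subseteq> B \<inter> T"
      using x T support_subset_basis by auto
    have vc: "v \<in> carrier M" and vs: "basis_support M C v \<subseteq> D"
      using v M_basis.mem_int_span_support[OF D] by auto
    have "act_supp P V \<subseteq> D"
      if "P \<in> basis_support R B x" "V \<in> basis_support M C v" for P V
    proof -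
      have "V \<in> D" "P \<in> B \<inter> T" using that xs vs by auto
      then show ?thesis using closed act_supp_subset_basis unfolding mod_adj_def by blast
    qed
    then have "act_supp x v \<subseteq> D" using act_supp_subset[OF xc vc] by blast
    then show ?thesis
      using M_basis.mem_int_span_support[OF D] smult_closed[OF xc vc] by blast
  qed
  then show "based_submodule M C T (int_span M D)"
    using D unfolding based_submodule_def by blast
qed

text \<open>Some \<open>V\<close> occurs in \<open>star Y W\<close>, so the row of \<open>W\<close> in the matrix of \<open>Y\<close> is not zero. The
  eigenvector equation at \<open>W\<close> then writes the eigenvalue as a quotient of positive numbers.\<close>

lemma FPdim_pos:
  assumes \<mu>: "FP_vector R B M C \<mu>" and Y: "Y \<in> B" and W: "W \<in> C"
  shows "0 < FPdim R B Y"
proof -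
  have pos: "0 < \<mu> V" if "V \<in> C" for V using \<mu> that unfolding FP_vector_def by blast
  obtain V where V: "V \<in> act_supp (star Y) W"
    using act_supp_nonempty[OF star_closed[OF Y] W] by blast
  then have VC: "V \<in> C" using act_supp_subset_basis by blast
  then have "coord M C (Y \<odot>\<^bsub>M\<^esub> V) W \<noteq> 0"
    using act_supp_sym[OF Y VC W] V by (simp add: basis_support_def)
  then have "0 < coord M C (Y \<odot>\<^bsub>M\<^esub> V) W" using action_nonneg[OF Y VC W] by simp
  then have "0 < \<mu> V * real_of_int (coord M C (Y \<odot>\<^bsub>M\<^esub> V) W)" using pos[OF VC] by simp
  also have "\<dots> \<le> (\<Sum>V\<in>C. \<mu> V * real_of_int (coord M C (Y \<odot>\<^bsub>M\<^esub> V) W))"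
    using VC M_basis.finite_basis pos action_nonneg[OF Y _ W]
    by (intro member_le_sum) (auto intro!: mult_nonneg_nonneg less_imp_le[OF pos])
  also have "\<dots> = FPdim R B Y * \<mu> W"
    using \<mu> basis_carrier[OF Y] W unfolding FP_vector_def by blast
  finally show ?thesis using pos[OF W] by (simp add: zero_less_mult_iff)
qed

text \<open>Both sides are the matrix entry \<open>(Y Q\<^sub>D, Q\<^sub>E) = (Q\<^sub>D, star Y Q\<^sub>E)\<close> of the restrictions of the
  eigenvector \<open>Q\<close> to \<open>D\<close> and \<open>E\<close>, evaluated with the eigenvector equation for \<open>Y\<close> and for
  \<open>star Y\<close>.\<close>

lemma FPdim_exchange:
  assumes \<mu>: "FP_vector R B M C \<mu>" and Y: "Y \<in> B" and DE: "D \<subseteq> C" "E \<subseteq> C"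
    and forwards: "\<And>V. V \<in> D \<Longrightarrow> act_supp Y V \<subseteq> E"
    and backwards: "\<And>W. W \<in> E \<Longrightarrow> act_supp (star Y) W \<subseteq> D"
  shows "FPdim R B Y * (\<Sum>W\<in>E. (\<mu> W)\<^sup>2) = FPdim R B (star Y) * (\<Sum>V\<in>D. (\<mu> V)\<^sup>2)"
proof -
  have eig: "FPdim R B Z * \<mu> W = (\<Sum>V\<in>C. \<mu> V * real_of_int (coord M C (Z \<odot>\<^bsub>M\<^esub> V) W))"
    if "Z \<in> B" "W \<in> C" for Z W
    using \<mu> that basis_carrier unfolding FP_vector_def by simp
  have eigD: "FPdim R B Y * \<mu> W = (\<Sum>V\<in>D. \<mu> V * real_of_int (coord M C (Y \<odot>\<^bsub>M\<^esub> V) W))"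
    if W: "W \<in> E" for W
  proof -
    have "coord M C (Y \<odot>\<^bsub>M\<^esub> V) W = 0" if V: "V \<in> C - D" for V
    proof -
      have "V \<notin> act_supp (star Y) W" using backwards[OF W] V by blast
      then show ?thesis
        using act_supp_sym[OF Y, of V W] V W DE by (auto simp: basis_support_def)
    qed
    moreover have "W \<in> C" using W DE by blast
    ultimately show ?thesis unfolding eig[OF Y \<open>W \<in> C\<close>]
      using DE M_basis.finite_basis by (intro sum.mono_neutral_right) auto
  qed
  have eigE: "FPdim R B (star Y) * \<mu> V
      = (\<Sum>W\<in>E. \<mu> W * real_of_int (coord M C (star Y \<odot>\<^bsub>M\<^esub> W) V))" if V: "V \<in> D" for V
  proof -
    have "coord M C (star Y \<odot>\<^bsub>M\<^esub> W) V = 0" if W: "W \<in> C - E" for W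
    proof -
      have "W \<notin> act_supp Y V" using forwards[OF V] W by blast
      then show ?thesis
        using act_supp_sym[OF Y, of V W] V W DE by (auto simp: basis_support_def)
    qed
    moreover have "V \<in> C" using V DE by blast
    ultimately show ?thesis unfolding eig[OF star_closed[OF Y] \<open>V \<in> C\<close>]
      using DE M_basis.finite_basis by (intro sum.mono_neutral_right) auto
  qed
  have "FPdim R B Y * (\<Sum>W\<in>E. (\<mu> W)\<^sup>2) = (\<Sum>W\<in>E. (FPdim R B Y * \<mu> W) * \<mu> W)"
    by (simp add: sum_distrib_left power2_eq_square mult.assoc)
  also have "\<dots> = (\<Sum>W\<in>E. \<Sum>V\<in>D. \<mu> V * real_of_int (coord M C (Y \<odot>\<^bsub>M\<^esub> V) W) * \<mu> W)"
    by (simp add: eigD sum_distrib_right)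
  also have "\<dots> = (\<Sum>V\<in>D. \<Sum>W\<in>E. \<mu> V * real_of_int (coord M C (Y \<odot>\<^bsub>M\<^esub> V) W) * \<mu> W)"
    by (rule sum.swap)
  also have "\<dots> = (\<Sum>V\<in>D. \<Sum>W\<in>E. \<mu> W * real_of_int (coord M C (star Y \<odot>\<^bsub>M\<^esub> W) V) * \<mu> V)"
  proof (intro sum.cong refl)
    fix V W assume "V \<in> D" "W \<in> E"
    then have "coord M C (Y \<odot>\<^bsub>M\<^esub> V) W = coord M C (star Y \<odot>\<^bsub>M\<^esub> W) V"
      using action_star[OF Y] DE by blast
    then show "\<mu> V * real_of_int (coord M C (Y \<odot>\<^bsub>M\<^esub> V) W) * \<mu> W
        = \<mu> W * real_of_int (coord M C (star Y \<odot>\<^bsub>M\<^esub> W) V) * \<mu> V" by simp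
  qed
  also have "\<dots> = (\<Sum>V\<in>D. (FPdim R B (star Y) * \<mu> V) * \<mu> V)"
    by (simp add: eigE sum_distrib_right)
  also have "\<dots> = FPdim R B (star Y) * (\<Sum>V\<in>D. (\<mu> V)\<^sup>2)"
    by (simp add: sum_distrib_left power2_eq_square mult.assoc)
  finally show ?thesis .
qed

lemma FP_vector_sum_pos:
  assumes \<mu>: "FP_vector R B M C \<mu>" and D: "D \<subseteq> C" "D \<noteq> {}"
  shows "0 < (\<Sum>V\<in>D. (\<mu> V)\<^sup>2)"
proof (rule sum_pos[OF finite_subset[OF D(1) M_basis.finite_basis] D(2)])
  fix V assume "V \<in> D"
  then have "0 < \<mu> V" using \<mu> D(1) unfolding FP_vector_def by blast
  then show "0 < (\<mu> V)\<^sup>2" by simp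
qed

text \<open>This is the exchange formula with both sets equal to the whole basis.\<close>

lemma FPdim_star:
  assumes \<mu>: "FP_vector R B M C \<mu>" and Y: "Y \<in> B" and "C \<noteq> {}"
  shows "FPdim R B (star Y) = FPdim R B Y"
proof -
  have "0 < (\<Sum>V\<in>C. (\<mu> V)\<^sup>2)" by (rule FP_vector_sum_pos[OF \<mu> subset_refl \<open>C \<noteq> {}\<close>])
  moreover have "FPdim R B Y * (\<Sum>V\<in>C. (\<mu> V)\<^sup>2) = FPdim R B (star Y) * (\<Sum>V\<in>C. (\<mu> V)\<^sup>2)"
    by (rule FPdim_exchange[OF \<mu> Y subset_refl subset_refl])
      (rule act_supp_subset_basis)+
  ultimately show ?thesis by simp
qed

end

section \<open>The action of the universal grading group\<close>

locale graded_based_module =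
  graded_based_ring R B star U Rc + based_module R B star M C
  for R :: "('a, 'e) ring_scheme" (structure) and B and star
    and U :: "('g, 'u) monoid_scheme" (structure) and Rc
    and M :: "('a, 'm, 'd) module_scheme" (structure) and C +
  fixes S :: "'s set" and Mc
  assumes module_indecomposable:
      "indecomposable M (based_submodule M C (carrier R)) (carrier M)"
    and decomposition: "indecomposable_decomposition M (based_submodule M C R_ad) S Mc"
begin

lemma summand_indecomposable:
  "x \<in> S \<Longrightarrow> indecomposable M (based_submodule M C R_ad) (Mc x)"
  using decomposition unfolding indecomposable_decomposition_def by blast

lemma summand_submodule: "x \<in> S \<Longrightarrow> based_submodule M C R_ad (Mc x)"
  using summand_indecomposable unfolding indecomposable_def by blast

lemma summand_based: "x \<in> S \<Longrightarrow> \<exists>D\<subseteq>C. Mc x = int_span M D"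
  using summand_submodule unfolding based_submodule_def by blast

lemma summand_sum: "direct_sum_family M S Mc"
  using decomposition unfolding indecomposable_decomposition_def by blast

lemma basis_summand:
  assumes "V \<in> C"
  obtains x where "x \<in> S" "V \<in> Mc x"
proof -
  have "\<exists>x\<in>S. V \<in> Mc x"
    by (rule M_basis.direct_sum_covers_basis[OF summand_sum summand_based assms])
  then show ?thesis using that by blast
qed

lemma summand_unique:
  "\<lbrakk>x \<in> S; y \<in> S; v \<in> Mc x; v \<in> Mc y; v \<noteq> \<zero>\<^bsub>M\<^esub>\<rbrakk> \<Longrightarrow> x = y"
  by (rule M_basis.direct_sum_index_unique[OF summand_sum summand_based])

lemma summand_basis_nonempty:
  assumes "x \<in> S"
  obtains V where "V \<in> C" "V \<in> Mc x"
  using M_basis.indecomposable_basis_nonempty[OF summand_indecomposable[OF assms]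
      summand_based[OF assms]] that by blast

lemma summand_support:
  "x \<in> S \<Longrightarrow> v \<in> Mc x \<longleftrightarrow> v \<in> carrier M \<and> basis_support M C v \<subseteq> Mc x"
  by (rule M_basis.mem_based_iff_support[OF summand_based])

lemma summand_stable:
  assumes "x \<in> S" "P \<in> R_ad" "V \<in> Mc x"
  shows "act_supp P V \<subseteq> Mc x"
proof -
  have "P \<odot>\<^bsub>M\<^esub> V \<in> Mc x"
    using summand_submodule[OF assms(1)] assms(2,3) unfolding based_submodule_def by blast
  then show ?thesis using summand_support[OF assms(1)] by blast
qed

lemma summand_connected:
  assumes x: "x \<in> S" and V: "V \<in> C" "V \<in> Mc x" and W: "W \<in> C" "W \<in> Mc x"
  shows "(\<lambda>V W. V \<in> C \<inter> Mc x \<and> W \<in> C \<inter> Mc x \<and> mod_adj R_ad V W)\<^sup>*\<^sup>* V W"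
proof -
  obtain D where D: "D \<subseteq> C" "Mc x = int_span M D" using summand_based[OF x] by blast
  have DC: "D = C \<inter> Mc x" by (rule M_basis.int_span_eq_basis_part[OF D])
  have sym: "mod_adj R_ad W V" if "V \<in> C" "W \<in> C" "mod_adj R_ad V W" for V W
    using mod_adj_sym[OF _ that] R_ad_star by blast
  show ?thesis
    using M_basis.indecomposable_connected[OF D(2) D(1)
        based_submodule_iff[OF R_ad_subset R_ad_support] sym summand_indecomposable[OF x], of V W]
      V W unfolding DC by blast
qed

lemma module_connected:
  assumes V: "V \<in> C" and W: "W \<in> C"
  shows "(\<lambda>V W. V \<in> C \<and> W \<in> C \<and> mod_adj (carrier R) V W)\<^sup>*\<^sup>* V W"
proof -
  have sym: "mod_adj (carrier R) W V" if "V \<in> C" "W \<in> C" "mod_adj (carrier R) V W" for V W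
    using mod_adj_sym[OF _ that] star_closed basis_carrier by blast
  have supp: "basis_support R B x \<subseteq> carrier R" for x
    using support_subset_basis basis_subset by blast
  show ?thesis
    by (rule M_basis.indecomposable_connected[OF M_basis.int_span_basis[symmetric] subset_refl
        based_submodule_iff[OF subset_refl supp] sym module_indecomposable V W])
qed

text \<open>If \<open>V'\<close> occurs in \<open>P V\<close> with \<open>P\<close> in the adjoint subring, then \<open>V\<close> occurs in
  \<open>star Y W\<close>, so every constituent of \<open>Y V'\<close> occurs in \<open>(Y P (star Y)) W\<close>, and \<open>Y P (star Y)\<close>
  lies in the adjoint subring again.\<close>

lemma same_summand_step:
  assumes Y: "Y \<in> B" and P: "P \<in> B" "P \<in> R_ad" and V: "V \<in> C" and V': "V' \<in> act_supp P V"
    and W: "W \<in> act_supp Y V" and W': "W' \<in> act_supp Y V'" and y: "y \<in> S" "W \<in> Mc y"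
  shows "W' \<in> Mc y"
proof -
  have WC: "W \<in> C" using W act_supp_subset_basis by blast
  have "V \<in> act_supp (star Y) W" using act_supp_sym[OF Y V WC] W by blast
  then have "V' \<in> (\<Union>Z\<in>prod_supp P (star Y). act_supp Z W)"
    using act_supp_compose[OF P(1) star_closed[OF Y] WC] V' by blast
  then obtain Z where Z: "Z \<in> prod_supp P (star Y)" "V' \<in> act_supp Z W" by blast
  have ZB: "Z \<in> B" using Z support_subset_basis by blast
  have "W' \<in> (\<Union>Q\<in>prod_supp Y Z. act_supp Q W)"
    using act_supp_compose[OF Y ZB WC] Z(2) W' by blast
  then obtain Q where Q: "Q \<in> prod_supp Y Z" "W' \<in> act_supp Q W" by blast
  have "Q \<in> R_ad" by (rule conjugate_R_ad[OF Y P Z(1) Q(1)])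
  then show ?thesis using summand_stable[OF y(1) _ y(2)] Q(2) by blast
qed

text \<open>A single basic element sends \<open>M\<^sub>x\<close> into one summand: walk from \<open>V\<close> to \<open>V'\<close> inside \<open>M\<^sub>x\<close>.
  The walk does not break off because \<open>Y\<close> kills no basic element.\<close>

lemma basic_same_summand:
  assumes Y: "Y \<in> B" and x: "x \<in> S" and V: "V \<in> C" "V \<in> Mc x"
    and y: "y \<in> S" "W \<in> act_supp Y V" "W \<in> Mc y" and V': "V' \<in> C" "V' \<in> Mc x"
  shows "act_supp Y V' \<subseteq> Mc y"
  using summand_connected[OF x V V']
proof (induction rule: rtranclp_induct)
  case base
  \<comment> \<open>Different constituents of the same \<open>Y V\<close> are compared by the step with \<open>P = 1\<close>.\<close>
  have "V \<in> act_supp \<one>\<^bsub>R\<^esub> V" using act_supp_one[OF V(1)] by simp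
  then show ?case
    using same_summand_step[OF Y one_basic R_ad_one V(1) _ y(2) _ y(1,3)] by blast
next
  case (step V1 V2)
  then have V1: "V1 \<in> C" "act_supp Y V1 \<subseteq> Mc y" by auto
  obtain P where P: "P \<in> B" "P \<in> R_ad" "V2 \<in> act_supp P V1"
    using step unfolding mod_adj_def by blast
  obtain W1 where W1: "W1 \<in> act_supp Y V1" using act_supp_nonempty[OF Y V1(1)] by blast
  have "W1 \<in> Mc y" using W1 V1(2) by blast
  then show ?case
    using same_summand_step[OF Y P(1,2) V1(1) P(3) W1 _ y(1)] by blast
qed

text \<open>Multiplying \<open>Y\<close> by elements of the adjoint subring does not change the target summand: on the
  left because the target is stable under them, on the right because the source is. All of \<open>R\<^sub>a\<close>
  is reached from \<open>Y\<close> in this way.\<close>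

lemma component_same_summand:
  assumes a: "a \<in> carrier U" and x: "x \<in> S" and y: "y \<in> S"
    and Y: "Y \<in> B" "Y \<in> Rc a" "\<And>V. V \<in> C \<Longrightarrow> V \<in> Mc x \<Longrightarrow> act_supp Y V \<subseteq> Mc y"
    and Z: "Z \<in> B" "Z \<in> Rc a" and V: "V \<in> C" "V \<in> Mc x"
  shows "act_supp Z V \<subseteq> Mc y"
  using component_connected[OF a Y(1,2) Z] V
proof (induction arbitrary: V rule: rtranclp_induct)
  case base
  then show ?case by (rule Y(3))
next
  case (step Z1 Z2)
  have Z1: "Z1 \<in> B" using step by blast
  obtain P where P: "P \<in> B" "P \<in> R_ad" "Z2 \<in> prod_supp P Z1 \<or> Z2 \<in> prod_supp Z1 P"
    using step(2) unfolding bimod_adj_def by blast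
  from P(3) show ?case
  proof
    assume "Z2 \<in> prod_supp P Z1"
    then have "act_supp Z2 V \<subseteq> (\<Union>W\<in>act_supp Z1 V. act_supp P W)"
      using act_supp_compose[OF P(1) Z1 step.prems(1)] by blast
    moreover have "act_supp Z1 V \<subseteq> Mc y" by (rule step.IH[OF step.prems])
    ultimately show ?thesis using summand_stable[OF y P(2)] by blast
  next
    assume "Z2 \<in> prod_supp Z1 P"
    then have "act_supp Z2 V \<subseteq> (\<Union>W\<in>act_supp P V. act_supp Z1 W)"
      using act_supp_compose[OF Z1 P(1) step.prems(1)] by blast
    moreover have "act_supp P V \<subseteq> C \<inter> Mc x"
      using summand_stable[OF x P(2) step.prems(2)] act_supp_subset_basis by blast
    ultimately show ?thesis using step.IH by blast
  qed
qed

definition maps_into :: "'g \<Rightarrow> 's \<Rightarrow> 's \<Rightarrow> bool" where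
  "maps_into a x y \<longleftrightarrow> (\<forall>r\<in>Rc a. \<forall>v\<in>Mc x. r \<odot>\<^bsub>M\<^esub> v \<in> Mc y)"

lemma maps_intoI:
  assumes a: "a \<in> carrier U" and x: "x \<in> S" and y: "y \<in> S"
    and basic: "\<And>Y V. \<lbrakk>Y \<in> B; Y \<in> Rc a; V \<in> C; V \<in> Mc x\<rbrakk> \<Longrightarrow> act_supp Y V \<subseteq> Mc y"
  shows "maps_into a x y"
  unfolding maps_into_def
proof (intro ballI)
  fix r v assume r: "r \<in> Rc a" and v: "v \<in> Mc x"
  have rc: "r \<in> carrier R" "basis_support R B r \<subseteq> Rc a"
    using mem_based_iff_support[OF component_based[OF a], of r] r by auto
  have vc: "v \<in> carrier M" "basis_support M C v \<subseteq> Mc x"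
    using summand_support[OF x, of v] v by auto
  have "act_supp Y V \<subseteq> Mc y"
    if "Y \<in> basis_support R B r" "V \<in> basis_support M C v" for Y V
    by (rule basic) (use that rc vc in \<open>auto simp: basis_support_def\<close>)
  then have "act_supp r v \<subseteq> Mc y" using act_supp_subset[OF rc(1) vc(1)] by blast
  then show "r \<odot>\<^bsub>M\<^esub> v \<in> Mc y"
    using summand_support[OF y] smult_closed[OF rc(1) vc(1)] by blast
qed

lemma basic_action_not_zero:
  assumes "Y \<in> B" "V \<in> C"
  shows "Y \<odot>\<^bsub>M\<^esub> V \<noteq> \<zero>\<^bsub>M\<^esub>"
proof -
  have "Y \<odot>\<^bsub>M\<^esub> V \<in> carrier M"
    by (rule smult_closed[OF basis_carrier[OF assms(1)] M_basis.basis_carrier[OF assms(2)]])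
  then show ?thesis using act_supp_nonempty[OF assms] M_basis.basis_support_empty_iff by blast
qed

lemma maps_into_ex1:
  assumes a: "a \<in> carrier U" and x: "x \<in> S"
  shows "\<exists>!y. y \<in> S \<and> maps_into a x y"
proof (rule ex_ex1I)
  obtain Y where Y: "Y \<in> B" "Y \<in> Rc a" by (rule component_basis_nonempty[OF a])
  obtain V where V: "V \<in> C" "V \<in> Mc x" by (rule summand_basis_nonempty[OF x])
  obtain W where W: "W \<in> act_supp Y V" using act_supp_nonempty[OF Y(1) V(1)] by blast
  then have "W \<in> C" using act_supp_subset_basis by blast
  then obtain y where y: "y \<in> S" "W \<in> Mc y" by (rule basis_summand)
  have "maps_into a x y"
  proof (rule maps_intoI[OF a x y(1)])
    fix Y' V' assume Y': "Y' \<in> B" "Y' \<in> Rc a" and V': "V' \<in> C" "V' \<in> Mc x"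
    show "act_supp Y' V' \<subseteq> Mc y"
      by (rule component_same_summand[OF a x y(1) Y _ Y' V'])
        (rule basic_same_summand[OF Y(1) x V y(1) W y(2)])
  qed
  then show "\<exists>y. y \<in> S \<and> maps_into a x y" using y(1) by blast
  fix y z assume yz: "y \<in> S \<and> maps_into a x y" "z \<in> S \<and> maps_into a x z"
  then have "Y \<odot>\<^bsub>M\<^esub> V \<in> Mc y" "Y \<odot>\<^bsub>M\<^esub> V \<in> Mc z"
    using Y V unfolding maps_into_def by auto
  then show "y = z"
    using summand_unique[OF _ _ _ _ basic_action_not_zero[OF Y(1) V(1)]] yz by blast
qed

definition translate :: "'g \<Rightarrow> 's \<Rightarrow> 's" where
  "translate a = (\<lambda>x\<in>S. THE y. y \<in> S \<and> maps_into a x y)"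

lemma translate:
  assumes "a \<in> carrier U" "x \<in> S"
  shows "translate a x \<in> S" "maps_into a x (translate a x)"
  using theI'[OF maps_into_ex1[OF assms]] assms(2) unfolding translate_def by auto

lemma translate_eq_iff:
  assumes "a \<in> carrier U" "x \<in> S" "y \<in> S"
  shows "translate a x = y \<longleftrightarrow> maps_into a x y"
  using translate[OF assms(1,2)] maps_into_ex1[OF assms(1,2)] assms(3) by blast

lemma translate_mem:
  "\<lbrakk>a \<in> carrier U; x \<in> S; r \<in> Rc a; v \<in> Mc x\<rbrakk> \<Longrightarrow> r \<odot>\<^bsub>M\<^esub> v \<in> Mc (translate a x)"
  using translate(2) unfolding maps_into_def by blast

text \<open>The non-zero element \<open>(Y \<otimes> Z) V = Y (Z V)\<close> lies in both summands.\<close>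

lemma translate_mult:
  assumes a: "a \<in> carrier U" and b: "b \<in> carrier U" and x: "x \<in> S"
  shows "translate (a \<otimes>\<^bsub>U\<^esub> b) x = translate a (translate b x)"
proof -
  obtain Y where Y: "Y \<in> B" "Y \<in> Rc a" by (rule component_basis_nonempty[OF a])
  obtain Z where Z: "Z \<in> B" "Z \<in> Rc b" by (rule component_basis_nonempty[OF b])
  obtain V where V: "V \<in> C" "V \<in> Mc x" by (rule summand_basis_nonempty[OF x])
  have ab: "a \<otimes>\<^bsub>U\<^esub> b \<in> carrier U" by (rule U.m_closed[OF a b])
  have VM: "V \<in> carrier M" by (rule M_basis.basis_carrier[OF V(1)])
  have YZ: "Y \<in> carrier R" "Z \<in> carrier R" using Y Z basis_carrier by auto
  have assoc: "(Y \<otimes>\<^bsub>R\<^esub> Z) \<odot>\<^bsub>M\<^esub> V = Y \<odot>\<^bsub>M\<^esub> (Z \<odot>\<^bsub>M\<^esub> V)" by (rule smult_assoc[OF YZ VM])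
  have "Y \<odot>\<^bsub>M\<^esub> (Z \<odot>\<^bsub>M\<^esub> V) \<in> Mc (translate a (translate b x))"
    by (rule translate_mem[OF a translate(1)[OF b x] Y(2) translate_mem[OF b x Z(2) V(2)]])
  moreover have "Y \<odot>\<^bsub>M\<^esub> (Z \<odot>\<^bsub>M\<^esub> V) \<in> Mc (translate (a \<otimes>\<^bsub>U\<^esub> b) x)"
    using translate_mem[OF ab x component_mult[OF a b Y(2) Z(2)] V(2)] assoc by simp
  moreover have "Y \<odot>\<^bsub>M\<^esub> (Z \<odot>\<^bsub>M\<^esub> V) \<noteq> \<zero>\<^bsub>M\<^esub>"
  proof -
    obtain W where W: "W \<in> act_supp Z V" using act_supp_nonempty[OF Z(1) V(1)] by blast
    then have "act_supp Y W \<noteq> {}" using act_supp_nonempty[OF Y(1)] act_supp_subset_basis by blast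
    then have "act_supp Y (Z \<odot>\<^bsub>M\<^esub> V) \<noteq> {}"
      using act_supp_act[OF Y(1) Z(1) V(1)] W by blast
    then show ?thesis
      using M_basis.basis_support_empty_iff[OF M.zero_closed] by force
  qed
  ultimately show ?thesis
    using summand_unique[OF translate(1)[OF ab x] translate(1)[OF a translate(1)[OF b x]]] by blast
qed

lemma translate_one:
  assumes x: "x \<in> S"
  shows "translate \<one>\<^bsub>U\<^esub> x = x"
proof -
  obtain V where V: "V \<in> C" "V \<in> Mc x" by (rule summand_basis_nonempty[OF x])
  have "\<one>\<^bsub>R\<^esub> \<odot>\<^bsub>M\<^esub> V \<in> Mc (translate \<one>\<^bsub>U\<^esub> x)"
    by (rule translate_mem[OF U.one_closed x one_component V(2)])
  then have "V \<in> Mc (translate \<one>\<^bsub>U\<^esub> x)"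
    using smult_one[OF M_basis.basis_carrier[OF V(1)]] by simp
  then show ?thesis
    using summand_unique[OF translate(1)[OF U.one_closed x] x _ V(2) M_basis.basis_not_zero[OF V(1)]]
    by blast
qed

lemma translate_inverse:
  assumes a: "a \<in> carrier U" and x: "x \<in> S"
  shows "translate (inv\<^bsub>U\<^esub> a) (translate a x) = x" "translate a (translate (inv\<^bsub>U\<^esub> a) x) = x"
  using translate_mult[OF U.inv_closed[OF a] a x] translate_mult[OF a U.inv_closed[OF a] x]
    translate_one[OF x] U.l_inv[OF a] U.r_inv[OF a] by auto

text \<open>Every basic element of \<open>R\<close> is homogeneous, so a walk from \<open>V\<close> to \<open>W\<close> under the action of \<open>R\<close>
  translates \<open>x\<close> by the product of the degrees along the walk.\<close>

lemma translate_transitive: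
  assumes x: "x \<in> S" and y: "y \<in> S"
  shows "\<exists>a\<in>carrier U. translate a x = y"
proof -
  obtain V where V: "V \<in> C" "V \<in> Mc x" by (rule summand_basis_nonempty[OF x])
  obtain W where W: "W \<in> C" "W \<in> Mc y" by (rule summand_basis_nonempty[OF y])
  have "\<exists>a\<in>carrier U. W \<in> Mc (translate a x)"
    using module_connected[OF V(1) W(1)]
  proof (induction rule: rtranclp_induct)
    case base
    have "V \<in> Mc (translate \<one>\<^bsub>U\<^esub> x)" using translate_one[OF x] V(2) by simp
    then show ?case using U.one_closed by blast
  next
    case (step W1 W2)
    obtain a where a: "a \<in> carrier U" "W1 \<in> Mc (translate a x)" using step.IH by blast
    obtain Y where Y: "Y \<in> B" "W2 \<in> act_supp Y W1" using step(2) unfolding mod_adj_def by blast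
    obtain b where b: "b \<in> carrier U" "Y \<in> Rc b" by (rule basis_component[OF Y(1)])
    have ba: "b \<otimes>\<^bsub>U\<^esub> a \<in> carrier U" by (rule U.m_closed[OF b(1) a(1)])
    have "Y \<odot>\<^bsub>M\<^esub> W1 \<in> Mc (translate (b \<otimes>\<^bsub>U\<^esub> a) x)"
      using translate_mem[OF b(1) translate(1)[OF a(1) x] b(2) a(2)]
        translate_mult[OF b(1) a(1) x] by simp
    then have "W2 \<in> Mc (translate (b \<otimes>\<^bsub>U\<^esub> a) x)"
      using summand_support[OF translate(1)[OF ba x]] Y(2) by blast
    then show ?case using ba by blast
  qed
  then obtain a where a: "a \<in> carrier U" "W \<in> Mc (translate a x)" by blast
  have "translate a x = y"
    by (rule summand_unique[OF translate(1)[OF a(1) x] y a(2) W(2) M_basis.basis_not_zero[OF W(1)]])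
  then show ?thesis using a(1) by blast
qed

lemma translate_Bij:
  assumes a: "a \<in> carrier U"
  shows "translate a \<in> Bij S"
proof -
  have "bij_betw (translate a) S S"
    using translate_inverse[OF a] translate(1)[OF a] translate(1)[OF U.inv_closed[OF a]]
    by (intro bij_betw_byWitness[where f' = "translate (inv\<^bsub>U\<^esub> a)"]) auto
  then show ?thesis unfolding Bij_def translate_def by auto
qed

lemma translate_action: "transitive_action U S (restrict translate (carrier U))"
proof -
  let ?\<phi> = "restrict translate (carrier U)"
  have "?\<phi> (a \<otimes>\<^bsub>U\<^esub> b) = compose S (?\<phi> a) (?\<phi> b)" if "a \<in> carrier U" "b \<in> carrier U" for a b
  proof (rule extensionalityI[of _ S])
    show "?\<phi> (a \<otimes>\<^bsub>U\<^esub> b) \<in> extensional S"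
      using U.m_closed[OF that] Bij_imp_extensional[OF translate_Bij] by simp
    show "compose S (?\<phi> a) (?\<phi> b) \<in> extensional S" by (rule compose_extensional)
    show "?\<phi> (a \<otimes>\<^bsub>U\<^esub> b) x = compose S (?\<phi> a) (?\<phi> b) x" if "x \<in> S" for x
      using translate_mult \<open>a \<in> carrier U\<close> \<open>b \<in> carrier U\<close> U.m_closed that
      by (simp add: compose_eq)
  qed
  then have "?\<phi> \<in> hom U (BijGroup S)"
    using translate_Bij by (auto simp: hom_def BijGroup_def)
  then have "group_hom U (BijGroup S) ?\<phi>"
    using U.group_axioms group_BijGroup by (simp add: group_hom_def group_hom_axioms_def)
  moreover have "\<exists>a\<in>carrier U. ?\<phi> a x = y" if "x \<in> S" "y \<in> S" for x y
    using translate_transitive[OF that] by auto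
  ultimately show ?thesis
    by (simp add: transitive_action_def group_action_def transitive_action_axioms_def)
qed

section \<open>Equality of the Frobenius-Perron dimensions\<close>

lemma FPdim_translate:
  assumes \<mu>: "FP_vector R B M C \<mu>" and a: "a \<in> carrier U" and x: "x \<in> S"
  shows "FPdim_sub C \<mu> (Mc (translate a x)) = FPdim_sub C \<mu> (Mc x)"
proof -
  let ?y = "translate a x"
  obtain Y where Y: "Y \<in> B" "Y \<in> Rc a" by (rule component_basis_nonempty[OF a])
  obtain V where V: "V \<in> C" by (rule summand_basis_nonempty[OF x])
  have y: "?y \<in> S" by (rule translate(1)[OF a x])
  have "FPdim R B Y * (\<Sum>W\<in>C \<inter> Mc ?y. (\<mu> W)\<^sup>2) = FPdim R B (star Y) * (\<Sum>V\<in>C \<inter> Mc x. (\<mu> V)\<^sup>2)"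
  proof (rule FPdim_exchange[OF \<mu> Y(1)])
    show "act_supp Y V \<subseteq> C \<inter> Mc ?y" if "V \<in> C \<inter> Mc x" for V
      using translate_mem[OF a x Y(2)] summand_support[OF y] that act_supp_subset_basis by blast
    show "act_supp (star Y) W \<subseteq> C \<inter> Mc x" if "W \<in> C \<inter> Mc ?y" for W
    proof -
      have "star Y \<odot>\<^bsub>M\<^esub> W \<in> Mc (translate (inv\<^bsub>U\<^esub> a) ?y)"
        using translate_mem[OF U.inv_closed[OF a] y star_component[OF a Y]] that by blast
      then show ?thesis
        using translate_inverse(1)[OF a x] summand_support[OF x] act_supp_subset_basis by simp
    qed
  qed auto
  moreover have "FPdim R B (star Y) = FPdim R B Y" using FPdim_star[OF \<mu> Y(1)] V by blast
  moreover have "FPdim R B Y \<noteq> 0" using FPdim_pos[OF \<mu> Y(1) V] by simp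
  ultimately show ?thesis unfolding FPdim_sub_def by simp
qed

lemma FPdim_sub_pos:
  assumes \<mu>: "FP_vector R B M C \<mu>" and x: "x \<in> S"
  shows "0 < FPdim_sub C \<mu> (Mc x)"
proof -
  obtain V where V: "V \<in> C" "V \<in> Mc x" by (rule summand_basis_nonempty[OF x])
  then show ?thesis
    unfolding FPdim_sub_def by (intro FP_vector_sum_pos[OF \<mu>]) auto
qed

end

theorem proposition5p1:
  fixes R :: "('a, 'e) ring_scheme" and B :: "'a set" and star :: "'a \<Rightarrow> 'a"
    and U :: "('g, 'u) monoid_scheme" and Rc :: "'g \<Rightarrow> 'a set"
    and M :: "('a, 'm, 'd) module_scheme" and C :: "'m set"
    and S :: "'s set" and Mc :: "'s \<Rightarrow> 'm set"
  assumes "based_ring R B star"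
    and "universal_grading R B star U Rc"
    and "based_module R B star M C"
    and "indecomposable M (based_submodule M C (carrier R)) (carrier M)"
    and "indecomposable_decomposition M
           (based_submodule M C (adjoint_subring R B star)) S Mc"
  shows "(\<exists>!\<phi>. \<phi> \<in> extensional (carrier U) \<and> transitive_action U S \<phi> \<and>
            (\<forall>a\<in>carrier U. \<forall>x\<in>S. \<forall>y\<in>S.
               \<phi> a x = y \<longleftrightarrow> (\<forall>r\<in>Rc a. \<forall>v\<in>Mc x. r \<odot>\<^bsub>M\<^esub> v \<in> Mc y))) \<and>
         (\<forall>\<mu>. FP_vector R B M C \<mu> \<longrightarrow>
            (\<forall>x\<in>S. \<forall>y\<in>S. FPdim_sub C \<mu> (Mc x) / FPdim_sub C \<mu> (Mc y) = 1))"
proof -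
  interpret graded_based_module R B star U Rc M C S Mc
    using assms
    by (intro graded_based_module.intro graded_based_ring.intro graded_based_ring_axioms.intro
        graded_based_module_axioms.intro)
  show ?thesis
  proof (intro conjI allI impI ballI)
    show "\<exists>!\<phi>. \<phi> \<in> extensional (carrier U) \<and> transitive_action U S \<phi> \<and>
            (\<forall>a\<in>carrier U. \<forall>x\<in>S. \<forall>y\<in>S.
               \<phi> a x = y \<longleftrightarrow> (\<forall>r\<in>Rc a. \<forall>v\<in>Mc x. r \<odot>\<^bsub>M\<^esub> v \<in> Mc y))"
      unfolding maps_into_def[symmetric]
    proof (rule ex1I[of _ "restrict translate (carrier U)"])
      show "restrict translate (carrier U) \<in> extensional (carrier U) \<and>
          transitive_action U S (restrict translate (carrier U)) \<and>
          (\<forall>a\<in>carrier U. \<forall>x\<in>S. \<forall>y\<in>S. restrict translate (carrier U) a x = y \<longleftrightarrow> maps_into a x y)"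
        using translate_action translate_eq_iff by simp
    next
      fix \<phi> assume \<phi>: "\<phi> \<in> extensional (carrier U) \<and> transitive_action U S \<phi> \<and>
          (\<forall>a\<in>carrier U. \<forall>x\<in>S. \<forall>y\<in>S. \<phi> a x = y \<longleftrightarrow> maps_into a x y)"
      then interpret act: transitive_action U S \<phi> by blast
      show "\<phi> = restrict translate (carrier U)"
      proof (rule extensionalityI[of _ "carrier U"])
        fix a assume a: "a \<in> carrier U"
        have "\<phi> a = translate a"
        proof (rule extensionalityI[of _ S])
          show "\<phi> a \<in> extensional S" by (rule Bij_imp_extensional[OF act.bij_prop0[OF a]])
          show "translate a \<in> extensional S" by (rule Bij_imp_extensional[OF translate_Bij[OF a]])
          show "\<phi> a x = translate a x" if x: "x \<in> S" for x
            using \<phi> a x translate[OF a x] by blast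
        qed
        then show "\<phi> a = restrict translate (carrier U) a" using a by simp
      qed (use \<phi> in auto)
    qed
  next
    fix \<mu> x y assume \<mu>: "FP_vector R B M C \<mu>" and x: "x \<in> S" and y: "y \<in> S"
    obtain a where "a \<in> carrier U" "translate a x = y" using translate_transitive[OF x y] by blast
    then have "FPdim_sub C \<mu> (Mc y) = FPdim_sub C \<mu> (Mc x)"
      using FPdim_translate[OF \<mu> _ x] by blast
    then show "FPdim_sub C \<mu> (Mc x) / FPdim_sub C \<mu> (Mc y) = 1"
      using FPdim_sub_pos[OF \<mu> x] by simp
  qed
qed

end
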